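(* Let $d=(d_1,\ldots,d_n)$ be a non-increasing sequence of positive integers such that $\sum_{i=1}^n d_i$ is an even number at most $2n-2$. If $\gamma^{\mathcal F}_{\min}(d)=k$, then there is a forest $F$ with vertex set $\{u_1,\ldots,u_n\}$ and $d_F(u_i)=d_i$ for every $i\in[n]$ such that (i) $D=\{u_1,\ldots,u_k\}$ and $\bar D=\{u_{k+1},\ldots,u_n\}$ are both dominating sets of $F$, (ii) $D$ or $\bar D$ is an independent set of $F$, (iii) if $F[D]$ has exactly $r$ isolated vertices for some $0\le r\le k$, then these are the vertices in $\{u_i:i\in[k]\setminus[k-r]\}$, and (iv) if $F[\bar D]$ has exactly $s$ isolated vertices for some $0\le s\le n-k$, then these are the vertices in $\{u_i:i\in[n]\setminus[n-s]\}$.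
   Context: All graphs are finite, simple and undirected. $[m]=\{1,\ldots,m\}$ for a positive integer $m$, and $[0]=\emptyset$. $d_F(u)$ is the degree of $u$ in $F$, and $F[U]$ is the subgraph of $F$ induced by $U$. For a sequence $d$ of non-negative integers, $\mathcal{F}(d)$ is the set of all forests with degree sequence $d$. A set $D$ of vertices of a graph $G$ is a dominating set if every vertex in $V(G)\setminus D$ has a neighbor in $D$; $\gamma(G)$ is the minimum order of a dominating set of $G$. $\gamma^{\mathcal F}_{\min}(d)=\min\{\gamma(F):F\in\mathcal{F}(d)\}$. (It is well known that a sequence $d$ as in the statement is the degree sequence of some forest, so this minimum exists.) *)

theory Defs
  imports "Graph_Theory.Digraph_Component"
begin

text \<open>
  Finite simple undirected graphs are the symmetric, loop-free, finite digraphs without parallel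
  arcs of the locale \<^locale>\<open>graph\<close>: every edge is a pair of opposite arcs, so
  \<^const>\<open>out_degree\<close> is the degree and \<^const>\<open>induce_subgraph\<close> yields the induced subgraph.
\<close>

text \<open>
  The constant \<^const>\<open>forest\<close> of the library is not usable here, since it counts an edge
  traversed back and forth as a cycle. In a simple graph the undirected cycles are exactly the
  directed cycles with at least three arcs.
\<close>

definition undirected_forest :: "('a, 'b) pre_digraph \<Rightarrow> bool" where
  "undirected_forest G \<longleftrightarrow> graph G \<and> \<not> (\<exists>p. pre_digraph.cycle G p \<and> 3 \<le> length p)"

definition dominating_set :: "('a, 'b) pre_digraph \<Rightarrow> 'a set \<Rightarrow> bool" where
  "dominating_set G D \<longleftrightarrow> D \<subseteq> verts G \<and> (\<forall>v \<in> verts G - D. \<exists>u \<in> D. v \<rightarrow>\<^bsub>G\<^esub> u)"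

definition domination_number :: "('a, 'b) pre_digraph \<Rightarrow> nat" where
  "domination_number G = (LEAST m. \<exists>D. dominating_set G D \<and> card D = m)"

definition independent_set :: "('a, 'b) pre_digraph \<Rightarrow> 'a set \<Rightarrow> bool" where
  "independent_set G A \<longleftrightarrow> A \<subseteq> verts G \<and> (\<forall>u \<in> A. \<forall>v \<in> A. \<not> u \<rightarrow>\<^bsub>G\<^esub> v)"

definition isolated_verts :: "('a, 'b) pre_digraph \<Rightarrow> 'a set" where
  "isolated_verts G = {v \<in> verts G. out_degree G v = 0}"

text \<open>
  A sequence \<open>d\<^sub>1, \<dots>, d\<^sub>n\<close> is a function \<open>d\<close> of which only the values on \<open>{1..n}\<close> matter.
  Every finite graph has an isomorphic copy whose vertices are natural numbers, so forests with
  vertices in \<^typ>\<open>nat\<close> suffice.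
\<close>

definition degree_sequence_via ::
    "('a, 'b) pre_digraph \<Rightarrow> nat \<Rightarrow> (nat \<Rightarrow> nat) \<Rightarrow> (nat \<Rightarrow> 'a) \<Rightarrow> bool" where
  "degree_sequence_via G n d u \<longleftrightarrow>
     bij_betw u {1..n} (verts G) \<and> (\<forall>i \<in> {1..n}. out_degree G (u i) = d i)"

definition forests :: "nat \<Rightarrow> (nat \<Rightarrow> nat) \<Rightarrow> nat pair_pre_digraph set" where
  "forests n d = {F. undirected_forest (with_proj F) \<and>
     (\<exists>u. degree_sequence_via (with_proj F) n d u)}"

definition min_forest_domination :: "nat \<Rightarrow> (nat \<Rightarrow> nat) \<Rightarrow> nat" where
  "min_forest_domination n d = (LEAST m. \<exists>F \<in> forests n d. domination_number (with_proj F) = m)"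

end

theory Submission
  imports Defs
begin

text \<open>
  Write \<open>a\<close> and \<open>b\<close> for the degree sums of \<open>D\<close> and of its complement, and \<open>q\<close> for the number of
  vertices of degree at least two outside \<open>D\<close>. If \<open>D\<close> dominates a forest, then \<open>n - |D| \<le> a\<close>, and
  \<open>b \<le> a + 2 (q - 1)\<close> (truncated), because every edge inside the complement joins two of those \<open>q\<close>
  vertices, which span at most \<open>q - 1\<close> edges. Both inequalities survive when \<open>D\<close> is replaced by
  the \<open>|D|\<close> vertices of largest degree. Conversely let \<open>k\<close> be the least number such that the first \<open>k\<close>
  degrees satisfy them; it is at most \<open>n / 2\<close>. If \<open>a \<le> b\<close>, one prescribes degrees with sum \<open>b - a\<close>
  inside the complement, supported on a prefix of it, and sends all other edges across; if \<open>a > b\<close>,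
  the roles are exchanged, and minimality of \<open>k\<close> makes the first \<open>k\<close> degrees at least two. A forest
  with these degrees exists: contracting the internal edges one by one leaves a bipartite degree
  problem, which is solved by removing leaves. So the inequalities characterise the minimum
  domination number, and the forest constructed has all the required properties.
\<close>

section \<open>Forests as sparse relations\<close>

text \<open>
  Edges are pairs of opposite arcs, so this says that a nonempty \<open>U\<close> spans at most \<open>|U| - 1\<close> edges.
  For symmetric relations it is equivalent to acyclicity, and it is easier to preserve under
  vertex splitting.
\<close>

definition sparse :: "'a rel \<Rightarrow> bool" where
  "sparse R \<longleftrightarrow> (\<forall>U. finite U \<longrightarrow> U \<noteq> {} \<longrightarrow> card (R \<inter> U \<times> U) + 2 \<le> 2 * card U)"

lemma sparseD: "sparse R \<Longrightarrow> finite U \<Longrightarrow> U \<noteq> {} \<Longrightarrow> card (R \<inter> U \<times> U) + 2 \<le> 2 * card U"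
  by (auto simp: sparse_def)

lemma sparse_irrefl:
  assumes "sparse R" shows "(v, v) \<notin> R"
proof
  assume "(v, v) \<in> R"
  then have "R \<inter> {v} \<times> {v} = {(v, v)}" by auto
  with sparseD[OF assms, of "{v}"] show False by simp
qed

lemma sparse_empty: "sparse {}"
proof -
  have "1 \<le> card U" if "finite U" "U \<noteq> {}" for U :: "'a set"
    using that by (simp add: Suc_le_eq card_gt_0_iff)
  then show ?thesis by (fastforce simp: sparse_def)
qed

text \<open>Deleting \<open>v\<close> from a vertex set removes at most the two arcs of the new edge
  and lowers twice the cardinality by two, so the bound for the smaller set carries over. The
  singleton \<open>{v}\<close> leaves no nonempty smaller set and is checked directly.\<close>

lemma sparse_add_leaf:
  assumes "sparse R" and v: "v \<notin> Field R" and "v \<noteq> w"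
  shows "sparse (R \<union> {(v, w), (w, v)})"
  unfolding sparse_def
proof (intro allI impI)
  fix U :: "'a set" assume U: "finite U" "U \<noteq> {}"
  let ?R = "R \<union> {(v, w), (w, v)}"
  show "card (?R \<inter> U \<times> U) + 2 \<le> 2 * card U"
  proof (cases "v \<in> U")
    case False
    then have "?R \<inter> U \<times> U = R \<inter> U \<times> U" by auto
    with sparseD[OF assms(1) U] show ?thesis by simp
  next
    case True
    show ?thesis
    proof (cases "U = {v}")
      case True
      then have "?R \<inter> U \<times> U = {}" using v \<open>v \<noteq> w\<close> by (auto simp: Field_def)
      with True show ?thesis by simp
    next
      case False
      let ?U = "U - {v}"
      have "?R \<inter> U \<times> U \<subseteq> (R \<inter> ?U \<times> ?U) \<union> {(v, w), (w, v)}"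
        using v by (auto simp: Field_def)
      then have "card (?R \<inter> U \<times> U) \<le> card ((R \<inter> ?U \<times> ?U) \<union> {(v, w), (w, v)})"
        using U by (intro card_mono) auto
      also have "\<dots> \<le> card (R \<inter> ?U \<times> ?U) + 2"
        using \<open>v \<noteq> w\<close> card_Un_le[of "R \<inter> ?U \<times> ?U" "{(v, w), (w, v)}"] by simp
      finally have "card (?R \<inter> U \<times> U) \<le> card (R \<inter> ?U \<times> ?U) + 2" .
      moreover have "card (R \<inter> ?U \<times> ?U) + 2 \<le> 2 * card ?U"
        using False True U by (intro sparseD[OF assms(1)]) auto
      moreover have "card U = card ?U + 1"
        using card_Suc_Diff1[of U] True U by (metis Suc_eq_plus1)
      ultimately show ?thesis by simp
    qed
  qed
qed

text \<open>This inverts the contraction of an edge: the new vertex \<open>z\<close> takes over the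
  neighbours in \<open>N\<close> from \<open>y\<close> and is joined to \<open>y\<close>.\<close>

definition split_vertex :: "'a rel \<Rightarrow> 'a \<Rightarrow> 'a set \<Rightarrow> 'a \<Rightarrow> 'a rel" where
  "split_vertex R y N z =
     (R - ({y} \<times> N \<union> N \<times> {y})) \<union> ({z} \<times> N \<union> N \<times> {z}) \<union> {(z, y), (y, z)}"

text \<open>Contracting \<open>z\<close> into \<open>y\<close> maps the arcs other than the new edge
  injectively into \<open>R\<close>. If a set contains both \<open>y\<close> and \<open>z\<close>,
  the two remaining arcs are paid for by the vertex that the contraction loses; otherwise they do
  not lie inside the set.\<close>

lemma sparse_split_vertex:
  assumes R: "sparse R" "sym R" and z: "z \<notin> Field R" "z \<noteq> y" and N: "N \<subseteq> R `` {y}"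
  shows "sparse (split_vertex R y N z)"
  unfolding sparse_def
proof (intro allI impI)
  fix U :: "'a set" assume U: "finite U" "U \<noteq> {}"
  let ?S = "split_vertex R y N z"
  let ?m = "\<lambda>v. if v = z then y else v"
  let ?f = "map_prod ?m ?m"
  define S0 where "S0 = ?S - {(z, y), (y, z)}"
  have irr: "(v, v) \<notin> R" for v using sparse_irrefl[OF R(1)] .
  have symR: "(a, b) \<in> R \<Longrightarrow> (b, a) \<in> R" for a b using R(2) by (auto dest: symD)
  have zR: "(z, a) \<notin> R" "(a, z) \<notin> R" for a using z by (auto simp: Field_def)
  have NR: "(y, x) \<in> R" "(x, y) \<in> R" if "x \<in> N" for x using N that symR by auto
  have yN: "y \<notin> N" "z \<notin> N" using NR(1) irr zR by blast+
  have S0: "((a, b) \<in> R \<and> a \<noteq> z \<and> b \<noteq> z \<and> \<not> (a = y \<and> b \<in> N) \<and> \<not> (b = y \<and> a \<in> N))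
      \<or> (a = z \<and> b \<in> N) \<or> (b = z \<and> a \<in> N)" if "(a, b) \<in> S0" for a b
    using that zR unfolding S0_def split_vertex_def by blast
  \<comment> \<open>\<open>g\<close> inverts the contraction on \<open>S0\<close>: after the split
    \<open>y\<close> has no neighbour in \<open>N\<close>, so an arc of the image between
    \<open>y\<close> and \<open>N\<close> can only come from \<open>z\<close>.\<close>
  define g where "g = (\<lambda>(p, q). if p = y \<and> q \<in> N then (z, q)
    else if q = y \<and> p \<in> N then (p, z) else (p, q))"
  have "g (?f (a, b)) = (a, b)" if "(a, b) \<in> S0" for a b
    using S0[OF that] yN z(2) by (elim disjE conjE) (simp_all add: g_def, auto)
  then have inj: "inj_on ?f S0"
    by (intro inj_on_inverseI[of _ g]) auto
  have fR: "?f (a, b) \<in> R" if "(a, b) \<in> S0" for a b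
    using S0[OF that] NR yN by (elim disjE conjE) auto
  have "?f ` (S0 \<inter> U \<times> U) \<subseteq> R"
  proof (rule image_subsetI)
    fix p assume "p \<in> S0 \<inter> U \<times> U"
    then show "?f p \<in> R" using fR[of "fst p" "snd p"] by simp
  qed
  moreover have "?f ` (S0 \<inter> U \<times> U) \<subseteq> (?m ` U) \<times> (?m ` U)"
    by (rule image_subsetI) fastforce
  ultimately have img: "?f ` (S0 \<inter> U \<times> U) \<subseteq> R \<inter> (?m ` U) \<times> (?m ` U)" by blast
  have "card (S0 \<inter> U \<times> U) = card (?f ` (S0 \<inter> U \<times> U))"
    by (rule card_image[symmetric]) (rule inj_on_subset[OF inj], auto)
  also have "\<dots> \<le> card (R \<inter> (?m ` U) \<times> (?m ` U))"
    using img U by (intro card_mono) auto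
  also have "\<dots> + 2 \<le> 2 * card (?m ` U)"
    by (rule sparseD[OF R(1)]) (use U in blast)+
  finally have le: "card (S0 \<inter> U \<times> U) + 2 \<le> 2 * card (?m ` U)" by simp
  show "card (?S \<inter> U \<times> U) + 2 \<le> 2 * card U"
  proof (cases "y \<in> U \<and> z \<in> U")
    case False
    then have "?S \<inter> U \<times> U = S0 \<inter> U \<times> U" by (auto simp: S0_def)
    with le card_image_le[OF U(1), of ?m] show ?thesis by simp
  next
    case True
    have "?S \<inter> U \<times> U \<subseteq> (S0 \<inter> U \<times> U) \<union> {(z, y), (y, z)}" by (auto simp: S0_def)
    then have "card (?S \<inter> U \<times> U) \<le> card ((S0 \<inter> U \<times> U) \<union> {(z, y), (y, z)})"
      using U by (intro card_mono) auto
    also have "\<dots> \<le> card (S0 \<inter> U \<times> U) + 2"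
      using z card_Un_le[of "S0 \<inter> U \<times> U" "{(z, y), (y, z)}"] by simp
    finally have "card (?S \<inter> U \<times> U) \<le> card (S0 \<inter> U \<times> U) + 2" .
    moreover have "?m ` U = U - {z}" using True z by auto
    then have "card U = card (?m ` U) + 1"
      using card_Suc_Diff1[of U] True U by (metis Suc_eq_plus1)
    ultimately show ?thesis using le by simp
  qed
qed

section \<open>Forests with prescribed degrees across a bipartition\<close>

text \<open>Pigeonhole for an average below two. It supplies the vertex to be removed in both
  realization lemmas, once for the full demands and once for the demands inside one side.\<close>

lemma exists_leaf:
  fixes d :: "'a \<Rightarrow> nat"
  assumes "\<And>v. v \<in> V \<Longrightarrow> 1 \<le> d v" and "sum d V < 2 * card V"
  shows "\<exists>v \<in> V. d v = 1"
proof (rule ccontr)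
  assume "\<not> ?thesis"
  then have "2 \<le> d v" if "v \<in> V" for v using assms(1)[OF that] that by (cases "d v = 1") auto
  then have "sum (\<lambda>_. 2) V \<le> sum d V" by (rule sum_mono)
  with assms(2) show False by simp
qed

text \<open>Induction on the number of vertices. The last hypothesis says that the edges are fewer
  than the vertices, so there is a leaf; attaching it to a vertex of demand at least two on the
  other side leaves a smaller instance. If all demands are one, the two sides have equal size and a
  single edge is split off.\<close>

lemma bipartite_forest_realization:
  fixes d :: "'a \<Rightarrow> nat"
  assumes "finite X" "finite Y" "X \<inter> Y = {}" "\<And>v. v \<in> X \<union> Y \<Longrightarrow> 1 \<le> d v"
    "sum d X = sum d Y" "X \<union> Y \<noteq> {} \<Longrightarrow> sum d X + 1 \<le> card X + card Y"
  shows "\<exists>R. sym R \<and> sparse R \<and> R \<subseteq> X \<times> Y \<union> Y \<times> X \<and> (\<forall>v \<in> X \<union> Y. card (R `` {v}) = d v)"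
  using assms
proof (induction "card X + card Y" arbitrary: X Y d rule: less_induct)
  case less
  \<comment> \<open>Remove a leaf on one side whose neighbour on the other side keeps a positive demand.\<close>
  have step: ?case if L: "L \<union> W = X \<union> Y" "(L = X \<and> W = Y) \<or> (L = Y \<and> W = X)"
      and v: "v \<in> L" "d v = 1" and w: "w \<in> W" "2 \<le> d w" for L W v w
  proof -
    have fin: "finite L" "finite W" "L \<inter> W = {}" using L less.prems by auto
    define L' where "L' = L - {v}"
    define d' where "d' = d(w := d w - 1)"
    have d': "d' w = d w - 1" "\<And>a. a \<noteq> w \<Longrightarrow> d' a = d a" by (simp_all add: d'_def)
    have vw: "v \<noteq> w" "w \<notin> L" "v \<notin> W" using v w fin by auto
    have cL: "card L = card L' + 1" unfolding L'_def using card_Suc_Diff1[OF fin(1) v(1)] by simp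
    have sL: "sum d L = sum d' L' + 1"
    proof -
      have "sum d L = d v + sum d L'" unfolding L'_def using fin(1) v(1) by (rule sum.remove)
      moreover have "sum d L' = sum d' L'" by (rule sum.cong) (use vw in \<open>auto simp: L'_def d'_def\<close>)
      ultimately show ?thesis using v(2) by linarith
    qed
    have sW: "sum d W = sum d' W + 1"
    proof -
      have "sum d W = d w + sum d (W - {w})" "sum d' W = d' w + sum d' (W - {w})"
        using fin(2) w(1) by (rule sum.remove)+
      moreover have "sum d (W - {w}) = sum d' (W - {w})" by (rule sum.cong) (simp_all add: d')
      ultimately show ?thesis using w(2) d'(1) by linarith
    qed
    have eq: "sum d L = sum d W" using L less.prems(5) by auto
    have bd: "sum d L + 1 \<le> card L + card W" using L less.prems(5) less.prems(6) v by (metis Un_empty add.commute empty_iff)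
    have "\<exists>R. sym R \<and> sparse R \<and> R \<subseteq> L' \<times> W \<union> W \<times> L'
        \<and> (\<forall>v \<in> L' \<union> W. card (R `` {v}) = d' v)"
    proof (rule less.hyps[of L' W d'])
      show "card L' + card W < card X + card Y" using cL L(2) by auto
      show "1 \<le> d' a" if "a \<in> L' \<union> W" for a
      proof (cases "a = w")
        case False
        have "a \<in> X \<union> Y" using that L(1) by (auto simp: L'_def)
        then show ?thesis using less.prems(4)[of a] False d'(2) by simp
      qed (use w d'(1) in simp)
      show "sum d' L' = sum d' W" using eq sL sW by linarith
      show "sum d' L' + 1 \<le> card L' + card W" using bd sL cL by linarith
    qed (use fin in \<open>auto simp: L'_def\<close>)
    then obtain R where R: "sym R" "sparse R" "R \<subseteq> L' \<times> W \<union> W \<times> L'"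
      "\<And>a. a \<in> L' \<union> W \<Longrightarrow> card (R `` {a}) = d' a" by blast
    let ?R = "R \<union> {(v, w), (w, v)}"
    have "finite (R `` {w})" by (rule finite_subset[of _ L']) (use R(3) fin vw in \<open>auto simp: L'_def\<close>)
    have vR: "v \<notin> Field R" using R(3) vw by (auto simp: Field_def L'_def)
    have "sym ?R" using R(1) by (auto simp: sym_def)
    moreover have "sparse ?R" using R(2) vR vw(1) by (rule sparse_add_leaf)
    moreover have "?R \<subseteq> X \<times> Y \<union> Y \<times> X" using R(3) L(2) v w by (auto simp: L'_def)
    moreover have "card (?R `` {a}) = d a" if "a \<in> X \<union> Y" for a
    proof -
      consider "a = v" | "a = w" | "a \<noteq> v" "a \<noteq> w" by auto
      then show ?thesis
      proof cases
        case 1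
        then have "?R `` {a} = {w}" using vR by (auto simp: Field_def)
        with 1 v show ?thesis by simp
      next
        case 2
        then have "?R `` {a} = insert v (R `` {w})" using vw by auto
        moreover have "v \<notin> R `` {w}" using vR by (auto simp: Field_def)
        ultimately show ?thesis using 2 R(4)[of w] w d' \<open>finite (R `` {w})\<close> by simp
      next
        case 3
        then have "?R `` {a} = R `` {a}" by auto
        moreover have "a \<in> L' \<union> W" using that 3 L(1) by (auto simp: L'_def)
        ultimately show ?thesis using R(4)[of a] 3 d' by simp
      qed
    qed
    ultimately show ?thesis by blast
  qed
  show ?case
  proof (cases "X \<union> Y = {}")
    case True
    then show ?thesis by (intro exI[of _ "{}"]) (auto simp: sparse_empty sym_def)
  next
    case False
    have bd: "sum d X + 1 \<le> card X + card Y" using less.prems(6) False by blast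
    have cV: "card (X \<union> Y) = card X + card Y" "sum d (X \<union> Y) = sum d X + sum d Y"
      using less.prems by (auto simp: card_Un_disjoint sum.union_disjoint)
    have "sum d (X \<union> Y) < 2 * card (X \<union> Y)"
      using less.prems(5) bd cV by linarith
    with less.prems obtain l where l: "l \<in> X \<union> Y" "d l = 1"
      using exists_leaf[of "X \<union> Y" d] by blast
    have ne: "X \<noteq> {} \<and> Y \<noteq> {}"
    proof -
      have pos: "Z \<noteq> {} \<Longrightarrow> finite Z \<Longrightarrow> Z \<subseteq> X \<union> Y \<Longrightarrow> 0 < sum d Z" for Z
        using less.prems(4) by (intro sum_pos) (auto simp: Suc_le_eq subset_iff)
      show ?thesis
      proof (rule ccontr)
        assume "\<not> ?thesis"
        then consider "X = {}" "Y \<noteq> {}" | "X \<noteq> {}" "Y = {}" using False by blast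
        then show False using pos[of X] pos[of Y] less.prems(1,2,5) by cases auto
      qed
    qed
    \<comment> \<open>Given a vertex \<open>u\<close> of demand at least two, a leaf on the other
      side pairs with it. If there is none, the other side consists of vertices of demand at least
      two, and the leaf \<open>l\<close> must lie on the side of \<open>u\<close>.\<close>
    consider (a) v w where "v \<in> X" "d v = 1" "w \<in> Y" "2 \<le> d w"
      | (b) v w where "v \<in> Y" "d v = 1" "w \<in> X" "2 \<le> d w"
      | (c) "\<And>v. v \<in> X \<union> Y \<Longrightarrow> d v = 1"
    proof -
      have two: "2 \<le> d u" if "u \<in> X \<union> Y" "d u \<noteq> 1" for u
        using less.prems(4)[OF that(1)] that(2) by linarith
      show thesis
      proof (cases "\<forall>v \<in> X \<union> Y. d v = 1")
        case True with c show ?thesis by blast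
      next
        case False
        then obtain u where u: "u \<in> X \<union> Y" "d u \<noteq> 1" by blast
        show ?thesis
        proof (cases "u \<in> X")
          case True
          show ?thesis
          proof (cases "\<exists>v \<in> Y. d v = 1")
            case True with u \<open>u \<in> X\<close> two b show ?thesis by blast
          next
            case False
            obtain y where "y \<in> Y" using ne by auto
            with False l two a show ?thesis by blast
          qed
        next
          case False
          then have "u \<in> Y" using u by auto
          show ?thesis
          proof (cases "\<exists>v \<in> X. d v = 1")
            case True with u \<open>u \<in> Y\<close> two a show ?thesis by blast
          next
            case False
            obtain x where "x \<in> X" using ne by auto
            with False l two b show ?thesis by blast
          qed
        qed
      qed
    qed
    then show ?thesis
    proof cases
      case a then show ?thesis using step[of X Y v w] by auto
    next
      case b then show ?thesis using step[of Y X v w] by auto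
    next
      case c
      \<comment> \<open>Removing a leaf alone would leave its neighbour with demand zero, so both
        ends of an edge are removed. The sides stay equally large, and the bound holds as soon as a
        vertex remains.\<close>
      obtain v w where vw: "v \<in> X" "w \<in> Y" using ne by auto
      let ?X = "X - {v}" and ?Y = "Y - {w}"
      have cXY: "card X = card ?X + 1" "card Y = card ?Y + 1"
        using card_Suc_Diff1[OF less.prems(1) vw(1)] card_Suc_Diff1[OF less.prems(2) vw(2)] by auto
      have one: "sum d Z = card Z" if "Z \<subseteq> X \<union> Y" for Z
        using c that by (subst sum.cong[of Z Z d "\<lambda>_. 1"]) auto
      have s: "sum d X = card X" "sum d Y = card Y" "sum d ?X = card ?X" "sum d ?Y = card ?Y"
        by (rule one, auto)+
      have "\<exists>R. sym R \<and> sparse R \<and> R \<subseteq> ?X \<times> ?Y \<union> ?Y \<times> ?X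
          \<and> (\<forall>v \<in> ?X \<union> ?Y. card (R `` {v}) = d v)"
      proof (rule less.hyps[of ?X ?Y d])
        show "card ?X + card ?Y < card X + card Y" using cXY by linarith
        show "sum d ?X = sum d ?Y" using less.prems(5) s cXY by linarith
        show "sum d ?X + 1 \<le> card ?X + card ?Y" if "?X \<union> ?Y \<noteq> {}"
        proof -
          have "card ?X = card ?Y" using less.prems(5) s cXY by linarith
          moreover have "0 < card (?X \<union> ?Y)" using that less.prems by (simp add: card_gt_0_iff)
          then have "0 < card ?X + card ?Y" using card_Un_le[of ?X ?Y] by linarith
          ultimately show ?thesis using s by linarith
        qed
        show "1 \<le> d a" if "a \<in> ?X \<union> ?Y" for a using less.prems(4)[of a] that by auto
      qed (use less.prems(1-3) in auto)
      then obtain R where R: "sym R" "sparse R" "R \<subseteq> ?X \<times> ?Y \<union> ?Y \<times> ?X"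
        "\<And>a. a \<in> ?X \<union> ?Y \<Longrightarrow> card (R `` {a}) = d a" by blast
      let ?R = "R \<union> {(v, w), (w, v)}"
      have nF: "v \<notin> Field R" "w \<notin> Field R" "v \<noteq> w"
        using R(3) vw less.prems(3) by (auto simp: Field_def)
      have "sym ?R" using R(1) by (auto simp: sym_def)
      moreover have "sparse ?R" using R(2) nF(1,3) by (rule sparse_add_leaf)
      moreover have "?R \<subseteq> X \<times> Y \<union> Y \<times> X" using R(3) vw by auto
      moreover have "card (?R `` {a}) = d a" if "a \<in> X \<union> Y" for a
      proof -
        consider "a = v" | "a = w" | "a \<noteq> v" "a \<noteq> w" by auto
        then show ?thesis
        proof cases
          case 1
          then have "?R `` {a} = {w}" using nF by (auto simp: Field_def)
          with 1 c that show ?thesis by simp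
        next
          case 2
          then have "?R `` {a} = {v}" using nF by (auto simp: Field_def)
          with 2 c that show ?thesis by simp
        next
          case 3
          then have "?R `` {a} = R `` {a}" by auto
          then show ?thesis using R(4)[of a] 3 that by simp
        qed
      qed
      ultimately show ?thesis by blast
    qed
  qed
qed

section \<open>Forests with additional edges inside one side\<close>

lemma sym_split_vertex: "sym R \<Longrightarrow> sym (split_vertex R y N z)"
  unfolding split_vertex_def sym_def by blast

text \<open>Here \<open>c\<close> prescribes the degrees across and \<open>e\<close> those inside
  \<open>Y\<close>, while \<open>X\<close> is independent. Induction on the number \<open>m\<close>
  of edges inside \<open>Y\<close>: an internal edge from \<open>y\<close> to a vertex
  \<open>z\<close> with \<open>e z = 1\<close> is contracted, which adds up the cross demands, and
  splitting \<open>y\<close> in the resulting forest restores it. The support of \<open>e\<close>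
  must have room for a forest with \<open>m\<close> edges.\<close>

lemma forest_realization:
  fixes c e :: "'a \<Rightarrow> nat"
  assumes "finite X" "finite Y" "X \<inter> Y = {}" "\<And>v. v \<in> X \<union> Y \<Longrightarrow> 1 \<le> c v"
    "sum c X = sum c Y" "sum e Y = 2 * m" "m = 0 \<or> m + 1 \<le> card {y \<in> Y. 1 \<le> e y}"
    "X \<union> Y \<noteq> {} \<Longrightarrow> sum c X + m + 1 \<le> card X + card Y"
  shows "\<exists>R. sym R \<and> sparse R \<and> R \<subseteq> (X \<union> Y) \<times> (X \<union> Y)
    \<and> (\<forall>v \<in> X. R `` {v} \<subseteq> Y \<and> card (R `` {v}) = c v)
    \<and> (\<forall>v \<in> Y. card (R `` {v} \<inter> X) = c v \<and> card (R `` {v} \<inter> Y) = e v)"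
  using assms
proof (induction m arbitrary: Y c e)
  case 0
  from bipartite_forest_realization[of X Y c] 0
  obtain R where R: "sym R" "sparse R" "R \<subseteq> X \<times> Y \<union> Y \<times> X"
    "\<And>v. v \<in> X \<union> Y \<Longrightarrow> card (R `` {v}) = c v" by auto
  have "e v = 0" if "v \<in> Y" for v using 0(2,6) that by simp
  moreover have "R `` {v} \<subseteq> Y" if "v \<in> X" for v using R(3) that 0(3) by auto
  moreover have "R `` {v} \<inter> X = R `` {v}" "R `` {v} \<inter> Y = {}" if "v \<in> Y" for v
    using R(3) that 0(3) by auto
  moreover have "R \<subseteq> (X \<union> Y) \<times> (X \<union> Y)" using R(3) by auto
  ultimately show ?case using R(1,2,4) by (intro exI[of _ R]) simp
next
  case (Suc m)
  note fin = Suc.prems(1,2) and disj = Suc.prems(3)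
  let ?S = "{y \<in> Y. 1 \<le> e y}"
  have finS: "finite ?S" using fin by simp
  have sumS: "sum e ?S = 2 * m + 2"
  proof -
    have "sum e ?S = sum e Y" using fin by (intro sum.mono_neutral_left) auto
    with Suc.prems(6) show ?thesis by simp
  qed
  have cardS: "m + 2 \<le> card ?S" using Suc.prems(7) by linarith
  \<comment> \<open>The internal demands add up to \<open>2 * m + 2\<close>, less than twice the
    number of vertices in the support, which is at least \<open>m + 2\<close>.\<close>
  have "\<exists>z \<in> ?S. e z = 1" by (rule exists_leaf) (use sumS cardS in auto)
  then obtain z where z: "z \<in> Y" "e z = 1" by auto
  \<comment> \<open>If the internal demand of \<open>y\<close> is at least two, the support loses
    only \<open>z\<close> in the contraction. If all positive internal demands are one, it loses
    \<open>y\<close> as well, but then it has exactly \<open>2 * m + 2\<close> elements, and the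
    remaining \<open>2 * m\<close> are enough.\<close>
  obtain y where y: "y \<in> Y" "y \<noteq> z" "1 \<le> e y" "2 \<le> e y \<or> (\<forall>v \<in> ?S. e v = 1)"
  proof (cases "\<exists>y \<in> Y. 2 \<le> e y")
    case True
    then show ?thesis using z that by force
  next
    case False
    have one: "\<forall>v \<in> ?S. e v = 1"
    proof
      fix v assume "v \<in> ?S"
      with False have "v \<in> Y" "1 \<le> e v" "\<not> 2 \<le> e v" by auto
      then show "e v = 1" by simp
    qed
    have "\<not> ?S \<subseteq> {z}" using cardS card_mono[of "{z}" ?S] by auto
    with one that show ?thesis by blast
  qed
  define Y' where "Y' = Y - {z}"
  define c' where "c' = c(y := c y + c z)"
  define e' where "e' = e(y := e y - 1)"
  have c': "c' y = c y + c z" "\<And>v. v \<noteq> y \<Longrightarrow> c' v = c v" by (simp_all add: c'_def)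
  have e': "e' y = e y - 1" "\<And>v. v \<noteq> y \<Longrightarrow> e' v = e v" by (simp_all add: e'_def)
  have yX: "y \<notin> X" "z \<notin> X" using y z disj by auto
  have yY': "y \<in> Y'" "finite Y'" "z \<notin> Y'" using y fin by (auto simp: Y'_def)
  have sums: "sum f Y = f z + (f y + sum f (Y' - {y}))" "sum f Y' = f y + sum f (Y' - {y})"
    for f :: "'a \<Rightarrow> nat"
    using sum.remove[OF fin(2) z(1), of f] sum.remove[OF yY'(2,1), of f] by (simp_all add: Y'_def)
  have rest: "sum c' (Y' - {y}) = sum c (Y' - {y})" "sum e' (Y' - {y}) = sum e (Y' - {y})"
    using c' e' by (auto intro: sum.cong)
  have sc: "sum c' Y' = sum c Y" using sums(1)[of c] sums(2)[of c'] rest c'(1) by linarith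
  have se: "sum e' Y' = 2 * m"
    using sums(1)[of e] sums(2)[of e'] rest e'(1) Suc.prems(6) z(2) y(3) by simp
  have sX: "sum c' X = sum c X" using yX by (intro sum.cong) (auto simp: c'_def)
  have cY: "card Y = card Y' + 1"
    using card_Suc_Diff1[OF fin(2) z(1)] by (simp add: Y'_def)
  have supp: "m = 0 \<or> m + 1 \<le> card {v \<in> Y'. 1 \<le> e' v}"
    using y(4)
  proof
    assume "2 \<le> e y"
    then have E: "{v \<in> Y'. 1 \<le> e' v} = ?S - {z}"
      using y by (auto simp: Y'_def e'_def)
    have "Suc (card (?S - {z})) = card ?S" using finS z by (intro card_Suc_Diff1) auto
    then show ?thesis unfolding E using cardS by linarith
  next
    assume one: "\<forall>v \<in> ?S. e v = 1"
    have yz: "y \<in> ?S" "z \<in> ?S" using y z by auto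
    have E: "{v \<in> Y'. 1 \<le> e' v} = ?S - {z} - {y}"
      using y(1,2) one yz by (auto simp: Y'_def e'_def split: if_splits)
    have "card ?S = sum e ?S" using one by (subst sum.cong[of ?S ?S e "\<lambda>_. 1"]) auto
    moreover have "Suc (card (?S - {z} - {y})) = card (?S - {z})"
      using finS yz(1) y(2) by (intro card_Suc_Diff1) auto
    ultimately show ?thesis
      unfolding E using sumS card_Suc_Diff1[OF finS yz(2)] by (intro disjCI) linarith
  qed
  have bd: "sum c X + Suc m + 1 \<le> card X + card Y" using Suc.prems(8) z(1) by blast
  have "\<exists>R. sym R \<and> sparse R \<and> R \<subseteq> (X \<union> Y') \<times> (X \<union> Y')
    \<and> (\<forall>v \<in> X. R `` {v} \<subseteq> Y' \<and> card (R `` {v}) = c' v)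
    \<and> (\<forall>v \<in> Y'. card (R `` {v} \<inter> X) = c' v \<and> card (R `` {v} \<inter> Y') = e' v)"
  proof (rule Suc.IH[OF fin(1) yY'(2) _ _ _ se supp])
    show "X \<inter> Y' = {}" using disj by (auto simp: Y'_def)
    show "1 \<le> c' v" if "v \<in> X \<union> Y'" for v
    proof -
      have "1 \<le> c v" using Suc.prems(4)[of v] that by (auto simp: Y'_def)
      then show ?thesis using c' by (cases "v = y") auto
    qed
    show "sum c' X = sum c' Y'" using sX sc Suc.prems(5) by simp
    show "sum c' X + m + 1 \<le> card X + card Y'" using bd sX cY by linarith
  qed
  then obtain R where R: "sym R" "sparse R" "R \<subseteq> (X \<union> Y') \<times> (X \<union> Y')"
    "\<And>v. v \<in> X \<Longrightarrow> R `` {v} \<subseteq> Y'" "\<And>v. v \<in> X \<Longrightarrow> card (R `` {v}) = c' v"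
    "\<And>v. v \<in> Y' \<Longrightarrow> card (R `` {v} \<inter> X) = c' v" "\<And>v. v \<in> Y' \<Longrightarrow> card (R `` {v} \<inter> Y') = e' v"
    by blast
  have finR: "finite (R `` {v})" for v
    by (rule finite_subset[of _ "X \<union> Y'"]) (use R(3) fin yY' in auto)
  have irr: "(v, v) \<notin> R" for v using sparse_irrefl[OF R(2)] .
  have zF: "z \<notin> Field R" using R(3) yX yY' by (auto simp: Field_def)
  have zR: "(z, a) \<notin> R" "(a, z) \<notin> R" for a using zF by (auto simp: Field_def)
  \<comment> \<open>In the contracted forest \<open>y\<close> has \<open>c y + c z\<close>
    neighbours in \<open>X\<close>; any \<open>c z\<close> of them are handed over to
    \<open>z\<close>.\<close>
  have "c z \<le> card (R `` {y} \<inter> X)" using R(6)[OF yY'(1)] c'(1) by simp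
  then obtain N where N: "N \<subseteq> R `` {y} \<inter> X" "card N = c z"
    using obtain_subset_with_card_n by metis
  have finN: "finite N" using N(1) fin(1) by (auto intro: finite_subset)
  have NR: "(y, x) \<in> R" "(x, y) \<in> R" "x \<in> X" if "x \<in> N" for x
    using N(1) that R(1) by (auto dest: symD)
  have yN: "y \<notin> N" "z \<notin> N" using N(1) yX by auto
  let ?T = "split_vertex R y N z"
  have "sym ?T" using R(1) by (rule sym_split_vertex)
  moreover have "sparse ?T"
    by (rule sparse_split_vertex[OF R(2,1) zF]) (use y(2) N(1) in auto)
  moreover have "?T \<subseteq> (X \<union> Y) \<times> (X \<union> Y)"
    using R(3) NR y(1) z(1) by (auto simp: split_vertex_def Y'_def)
  moreover have "?T `` {v} \<subseteq> Y \<and> card (?T `` {v}) = c v" if v: "v \<in> X" for v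
  proof (cases "v \<in> N")
    case True
    then have "?T `` {v} = insert z (R `` {v} - {y})"
      using yN v yX by (auto simp: split_vertex_def)
    moreover have "z \<notin> R `` {v} - {y}" "y \<in> R `` {v}" using zR NR[OF True] by auto
    ultimately have "card (?T `` {v}) = card (R `` {v})"
      using card_Suc_Diff1[OF finR, of y v] finR[of v] by simp
    then show ?thesis using \<open>?T `` {v} = _\<close> R(4,5)[OF v] c'(2)[of v] v yX z(1)
      by (auto simp: Y'_def)
  next
    case False
    then have "?T `` {v} = R `` {v}" using v yX by (auto simp: split_vertex_def)
    then show ?thesis using R(4,5)[OF v] c'(2)[of v] v yX by (auto simp: Y'_def)
  qed
  moreover have "card (?T `` {v} \<inter> X) = c v \<and> card (?T `` {v} \<inter> Y) = e v" if v: "v \<in> Y" for v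
  proof -
    consider "v = z" | "v = y" | "v \<noteq> z" "v \<noteq> y" by blast
    then show ?thesis
    proof cases
      case 1
      then have "?T `` {v} = insert y N" using zR y(2) yN by (auto simp: split_vertex_def)
      then have "?T `` {v} \<inter> X = N" "?T `` {v} \<inter> Y = {y}" using N(1) yX y(1) disj by auto
      then show ?thesis using N(2) z(2) 1 by simp
    next
      case 2
      then have "?T `` {v} = insert z (R `` {y} - N)"
        using irr yN y(2) by (auto simp: split_vertex_def)
      then have T: "?T `` {v} \<inter> X = R `` {y} \<inter> X - N" "?T `` {v} \<inter> Y = insert z (R `` {y} \<inter> Y')"
        using N(1) yX z(1) disj zR by (auto simp: Y'_def)
      have "card (R `` {y} \<inter> X - N) = c y"
        using card_Diff_subset[OF finN N(1)] R(6)[OF yY'(1)] c'(1) N(2) by simp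
      moreover have "card (insert z (R `` {y} \<inter> Y')) = e y"
        using R(7)[OF yY'(1)] e'(1) y(3) yY' by simp
      ultimately show ?thesis using T 2 by simp
    next
      case 3
      then have "v \<in> Y'" using v by (simp add: Y'_def)
      moreover have "v \<notin> N" using N(1) v disj by auto
      then have "?T `` {v} = R `` {v}" using 3 by (auto simp: split_vertex_def)
      moreover have "R `` {v} \<inter> Y = R `` {v} \<inter> Y'" using zR by (auto simp: Y'_def)
      ultimately show ?thesis using R(6,7) c'(2) e'(2) 3 by simp
    qed
  qed
  ultimately show ?case by blast
qed

section \<open>Sparse relations and cycles\<close>

lemma pcas_nth_Suc:
  "pcas u p v \<Longrightarrow> i < length p \<Longrightarrow> snd (p ! i) = (if Suc i < length p then fst (p ! Suc i) else v)"
proof (induction p arbitrary: u i)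
  case (Cons e p)
  then show ?case by (cases i; cases p) auto
qed simp

lemma pcas_tl_verts: "pcas u p v \<Longrightarrow> tl (pawalk_verts u p) = map snd p"
proof -
  have "pcas u p v \<Longrightarrow> pawalk_verts u p = u # map snd p" for u
    by (induction p arbitrary: u) auto
  then show "pcas u p v \<Longrightarrow> ?thesis" by simp
qed

text \<open>Reduces cycles of the graph to a condition on the list of arcs, the form in which both
  directions of the comparison with sparsity use them.\<close>

lemma cycle_with_proj_iff:
  "pre_digraph.cycle (with_proj F) p \<longleftrightarrow>
    (\<exists>u \<in> pverts F. set p \<subseteq> parcs F \<and> pcas u p u \<and> distinct (map snd p) \<and> p \<noteq> [])"
  unfolding pre_digraph.cycle_def pre_digraph.awalk_def
    cas_with_proj_eq awalk_verts_with_proj_eq with_proj_simps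
  by (auto simp: pcas_tl_verts)

text \<open>A cycle with \<open>L \<ge> 3\<close> arcs visits \<open>L\<close> vertices, and
  together with the reversed arcs it puts \<open>2 * L\<close> arcs between them, while sparsity
  allows only \<open>2 * L - 2\<close>.\<close>

lemma sparse_no_cycle:
  assumes R: "sparse R" "sym R" and p: "set p \<subseteq> R" "pcas u p u" "distinct (map snd p)"
  shows "length p < 3"
proof (rule ccontr)
  assume "\<not> ?thesis"
  then have L: "3 \<le> length p" by simp
  define L where "L = length p"
  \<comment> \<open>The cyclic successor of a position; it is a bijection on the positions, so the
    tails of the arcs are distinct as well as the heads.\<close>
  define nx where "nx i = (if Suc i < L then Suc i else 0)" for i
  have ne: "p \<noteq> []" using L by auto
  have u: "u = fst (p ! 0)" using p(2) ne by (cases p) auto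
  have step: "snd (p ! i) = fst (p ! nx i)" "nx i < L" if "i < L" for i
  proof -
    have "snd (p ! i) = (if Suc i < L then fst (p ! Suc i) else u)"
      using pcas_nth_Suc[OF p(2), of i] that by (simp add: L_def)
    then show "snd (p ! i) = fst (p ! nx i)" using u by (simp add: nx_def)
    show "nx i < L" using that by (simp add: nx_def)
  qed
  have dist: "i = j" if "snd (p ! i) = snd (p ! j)" "i < L" "j < L" for i j
    using p(3) that nth_eq_iff_index_eq[of "map snd p" i j] by (simp add: L_def)
  have nx_inj: "i = j" if "nx i = nx j" "i < L" "j < L" for i j
    using that by (auto simp: nx_def split: if_splits)
  have nx_surj: "\<exists>i < L. j = nx i" if "j < L" for j
  proof (cases j)
    case 0
    have "L - 1 < L" "0 = nx (L - 1)" using that by (simp_all add: nx_def)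
    with 0 show ?thesis by blast
  next
    case (Suc i)
    then have "i < L" "j = nx i" using that by (simp_all add: nx_def)
    then show ?thesis by blast
  qed
  have distf: "i = j" if "fst (p ! i) = fst (p ! j)" "i < L" "j < L" for i j
  proof -
    obtain a where "a < L" "i = nx a" using nx_surj[OF \<open>i < L\<close>] by blast
    moreover obtain b where "b < L" "j = nx b" using nx_surj[OF \<open>j < L\<close>] by blast
    ultimately have "snd (p ! a) = snd (p ! b)" using step(1)[of a] step(1)[of b] that(1) by simp
    with \<open>a < L\<close> \<open>b < L\<close> have "a = b" using dist by blast
    with \<open>i = nx a\<close> \<open>j = nx b\<close> show ?thesis by simp
  qed
  let ?U = "snd ` set p"
  have cardU: "card ?U = L" using distinct_card[OF p(3)] by (simp add: L_def)
  have "distinct p" using p(3) by (simp add: distinct_map)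
  then have cardp: "card (set p) = L" by (simp add: distinct_card L_def)
  have fU: "fst e \<in> ?U" if e: "e \<in> set p" for e
  proof -
    obtain i where i: "i < L" "e = p ! i" using e unfolding in_set_conv_nth L_def by metis
    obtain j where j: "j < L" "i = nx j" using nx_surj[OF i(1)] by blast
    then have "fst e = snd (p ! j)" using step(1)[of j] i by simp
    moreover have "p ! j \<in> set p" using j(1) by (simp add: L_def)
    ultimately show ?thesis by simp
  qed
  \<comment> \<open>An arc of the cycle and its reverse would each be followed by the other, which
    forces length at most two.\<close>
  have disj: "set p \<inter> (set p)\<inverse> = {}"
  proof (rule ccontr)
    assume "\<not> ?thesis"
    then obtain x y where xy: "(x, y) \<in> set p" "(y, x) \<in> set p" by auto
    obtain i where i: "i < L" "(x, y) = p ! i" using xy(1) unfolding in_set_conv_nth L_def by metis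
    obtain j where j: "j < L" "(y, x) = p ! j" using xy(2) unfolding in_set_conv_nth L_def by metis
    have "snd (p ! i) = y" "fst (p ! i) = x" using i(2) by (metis fst_conv snd_conv)+
    moreover have "snd (p ! j) = x" "fst (p ! j) = y" using j(2) by (metis fst_conv snd_conv)+
    ultimately have "fst (p ! nx i) = fst (p ! j)" "fst (p ! nx j) = fst (p ! i)"
      using step(1)[OF i(1)] step(1)[OF j(1)] by simp_all
    then have "nx i = j" "nx j = i" using distf step(2) i(1) j(1) by blast+
    then show False using i(1) j(1) L by (auto simp: nx_def L_def split: if_splits)
  qed
  have "set p \<union> (set p)\<inverse> \<subseteq> R \<inter> ?U \<times> ?U"
  proof
    fix e assume "e \<in> set p \<union> (set p)\<inverse>"
    then obtain a b where e: "e = (a, b)" "(a, b) \<in> set p \<or> (b, a) \<in> set p" by (cases e) auto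
    then have "a \<in> ?U" "b \<in> ?U" using fU[of "(a, b)"] fU[of "(b, a)"] by force+
    moreover have "(a, b) \<in> R" using e(2) p(1) R(2) by (auto dest: symD)
    ultimately show "e \<in> R \<inter> ?U \<times> ?U" using e(1) by simp
  qed
  then have "card (set p \<union> (set p)\<inverse>) \<le> card (R \<inter> ?U \<times> ?U)" by (intro card_mono) auto
  moreover have "card (set p \<union> (set p)\<inverse>) = L + L"
    using disj cardp by (subst card_Un_disjoint) auto
  ultimately show False using sparseD[OF R(1), of ?U] cardU ne by simp
qed

text \<open>The \<open>zip\<close> turns the vertex list \<open>a # as\<close>, continued by
  \<open>z\<close>, into the arcs of a walk; with \<open>z = a\<close> this closes a path to a
  cycle.\<close>

lemma pcas_zip: "pcas a (zip (a # as) (as @ [z])) z"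
  by (induction as arbitrary: a) auto

lemma successively_zip:
  "successively (\<lambda>a b. (a, b) \<in> R) (a # as) \<Longrightarrow> (last (a # as), z) \<in> R
    \<Longrightarrow> set (zip (a # as) (as @ [z])) \<subseteq> R"
  by (induction as arbitrary: a) auto

text \<open>Every nonempty finite vertex set contains a vertex with at most one neighbour in the
  set, since otherwise a longest path could be extended or closed to a cycle. Removing such vertices
  one at a time loses at most two arcs each, and the last vertex spans none.\<close>

lemma undirected_forest_imp_sparse:
  assumes "undirected_forest (with_proj F)"
  shows "sparse (parcs F)"
proof -
  let ?R = "parcs F"
  from assms have "graph (with_proj F)" by (simp add: undirected_forest_def)
  then interpret F: pair_graph F by (rule pair_graphI_graph)
  have irr: "(v, v) \<notin> ?R" for v using F.pair_no_loops[of "(v, v)"] by auto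
  have symR: "(a, b) \<in> ?R \<Longrightarrow> (b, a) \<in> ?R" for a b by (rule F.arcs_symmetric)
  have nocyc: "length p < 3" if "set p \<subseteq> ?R" "pcas u p u" "distinct (map snd p)" for p u
  proof (rule ccontr)
    assume L: "\<not> ?thesis"
    then obtain e p' where "p = e # p'" by (cases p) auto
    with that have "e \<in> ?R" "fst e = u" by auto
    then have "u \<in> pverts F" using F.arc_fst_in_verts by auto
    with that L have "pre_digraph.cycle (with_proj F) p"
      unfolding cycle_with_proj_iff by auto
    with L assms show False unfolding undirected_forest_def by auto
  qed
  have leaf: "\<exists>u \<in> U. card (?R `` {u} \<inter> U) \<le> 1" if U: "finite U" "U \<noteq> {}" for U
  proof (rule ccontr)
    assume neg: "\<not> ?thesis"
    define P where "P xs \<longleftrightarrow> xs \<noteq> [] \<and> distinct xs \<and> set xs \<subseteq> U \<and> successively (\<lambda>a b. (a, b) \<in> ?R) xs"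
      for xs
    obtain u where "u \<in> U" using U by auto
    then have "P [u]" by (simp add: P_def)
    moreover have "length xs < Suc (card U)" if "P xs" for xs
      using that card_mono[OF U(1), of "set xs"] by (simp add: P_def distinct_card less_Suc_eq_le)
    ultimately obtain xs where xs: "P xs" "\<And>ys. P ys \<Longrightarrow> length ys \<le> length xs"
      using ex_has_greatest_nat[of P "[u]" length "Suc (card U)"] by (auto intro: less_imp_le)
    then obtain x rest where x: "xs = x # rest" by (cases xs) (auto simp: P_def)
    let ?N = "?R `` {x} \<inter> U"
    have "x \<in> U" using xs(1) x by (simp add: P_def)
    then have "\<not> card ?N \<le> 1" using neg by blast
    then have "2 \<le> card ?N" by linarith
    moreover have "finite ?N" using U by simp
    \<comment> \<open>The first vertex \<open>x\<close> of a longest path has a neighbour other than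
      its successor. For empty \<open>rest\<close> the value \<open>hd rest\<close> is arbitrary; a
      neighbour \<open>w\<close> still exists, and maximality of the path then puts it into the
      empty \<open>rest\<close>, a contradiction.\<close>
    ultimately have "\<exists>w \<in> ?N. w \<noteq> hd rest"
      using card_mono[of "{hd rest}" ?N] by force
    then obtain w where w: "(x, w) \<in> ?R" "w \<in> U" "w \<noteq> hd rest" by auto
    have "w \<in> set xs"
    proof (rule ccontr)
      assume "w \<notin> set xs"
      then have "P (w # xs)" using xs(1) w symR x by (auto simp: P_def)
      from xs(2)[OF this] show False by simp
    qed
    moreover have "w \<noteq> x" using w(1) irr by auto
    ultimately have "w \<in> set rest" using x by simp
    then obtain as bs where split: "rest = as @ w # bs" by (meson split_list)
    \<comment> \<open>This makes the closed walk through \<open>x\<close>, \<open>as\<close> and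
      \<open>w\<close> at least three arcs long, so it is not an edge traversed back and
      forth.\<close>
    with w(3) have "as \<noteq> []" by auto
    let ?as = "as @ [w]"
    have "successively (\<lambda>a b. (a, b) \<in> ?R) (x # ?as)"
      using xs(1) x split by (auto simp: P_def successively_append_iff simp flip: append_Cons)
    moreover have "(last (x # ?as), x) \<in> ?R" using w(1) symR by simp
    ultimately have "set (zip (x # ?as) (?as @ [x])) \<subseteq> ?R" by (rule successively_zip)
    moreover have "pcas x (zip (x # ?as) (?as @ [x])) x" by (rule pcas_zip)
    moreover have "map snd (zip (x # ?as) (?as @ [x])) = ?as @ [x]" by (subst map_snd_zip) auto
    then have "distinct (map snd (zip (x # ?as) (?as @ [x])))"
      using xs(1) x split by (auto simp: P_def)
    ultimately have "length (zip (x # ?as) (?as @ [x])) < 3" by (rule nocyc)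
    with \<open>as \<noteq> []\<close> show False by (cases as) auto
  qed
  have "card (?R \<inter> U \<times> U) + 2 \<le> 2 * card U" if "finite U" "U \<noteq> {}" for U
    using that
  proof (induction "card U" arbitrary: U)
    case (Suc n)
    obtain u where u: "u \<in> U" "card (?R `` {u} \<inter> U) \<le> 1" using leaf Suc.prems by blast
    let ?N = "?R `` {u} \<inter> U" and ?U = "U - {u}"
    have cU: "card U = card ?U + 1" using card_Suc_Diff1[OF Suc.prems(1) u(1)] by simp
    show ?case
    proof (cases "?U = {}")
      case True
      then have "U = {u}" using u(1) by auto
      then have "?R \<inter> U \<times> U = {}" using irr by auto
      then show ?thesis using cU by simp
    next
      case False
      have "?R \<inter> U \<times> U \<subseteq> ?R \<inter> ?U \<times> ?U \<union> ({u} \<times> ?N \<union> ?N \<times> {u})" using symR by auto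
      then have "card (?R \<inter> U \<times> U) \<le> card (?R \<inter> ?U \<times> ?U \<union> ({u} \<times> ?N \<union> ?N \<times> {u}))"
        using Suc.prems(1) by (intro card_mono) auto
      also have "\<dots> \<le> card (?R \<inter> ?U \<times> ?U) + (card ({u} \<times> ?N) + card (?N \<times> {u}))"
        by (meson add_left_mono card_Un_le order_trans)
      also have "\<dots> \<le> card (?R \<inter> ?U \<times> ?U) + 2" using u(2) by (simp add: card_cartesian_product)
      finally have "card (?R \<inter> U \<times> U) \<le> card (?R \<inter> ?U \<times> ?U) + 2" .
      moreover have "card (?R \<inter> ?U \<times> ?U) + 2 \<le> 2 * card ?U"
        using Suc False cU by auto
      ultimately show ?thesis using cU by linarith
    qed
  qed auto
  then show ?thesis by (simp add: sparse_def)
qed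

lemma undirected_forestI:
  assumes V: "finite V" and R: "R \<subseteq> V \<times> V" "sym R" "sparse R"
  shows "undirected_forest (with_proj \<lparr>pverts = V, parcs = R\<rparr>)"
proof -
  let ?F = "\<lparr>pverts = V, parcs = R\<rparr>"
  have "finite R" using V R(1) by (auto intro: finite_subset)
  moreover have "symmetric (with_proj ?F)" using R(2) by (simp add: symmetric_def)
  ultimately interpret pair_graph ?F
    using V R(1) sparse_irrefl[OF R(3)] by unfold_locales auto
  have "graph (with_proj ?F)" by unfold_locales
  moreover have "length p < 3" if "pre_digraph.cycle (with_proj ?F) p" for p
    using that sparse_no_cycle[OF R(3,2)] unfolding cycle_with_proj_iff by auto
  ultimately show ?thesis unfolding undirected_forest_def by fastforce
qed

lemma out_degree_with_proj:
  "out_degree (with_proj F) v = card (parcs F `` {v})"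
proof -
  have "out_arcs (with_proj F) v = Pair v ` (parcs F `` {v})"
    by (auto simp: out_arcs_def image_iff)
  then show ?thesis by (simp add: out_degree_def card_image inj_on_def)
qed

section \<open>Bounds from a dominating set\<close>

lemma sum_card_Image_eq:
  assumes "finite V" "R \<subseteq> V \<times> V" "D \<subseteq> V"
  shows "(\<Sum>v\<in>D. card (R `` {v})) = card (R \<inter> D \<times> V)"
proof -
  have "R \<inter> D \<times> V = Sigma D (\<lambda>v. R `` {v})" using assms by auto
  moreover have "finite (R `` {v})" for v using assms by (auto intro: finite_subset[of _ V])
  ultimately show ?thesis using assms by (simp add: card_SigmaI finite_subset)
qed

text \<open>Every vertex outside \<open>D\<close> sends an arc into \<open>D\<close>, which gives
  the first bound. If it also has a neighbour outside \<open>D\<close>, its degree is at least two;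
  hence the arcs inside the complement live on \<open>?H\<close> and are bounded by sparsity. Adding
  \<open>sum \<delta> D\<close> to both sides of the resulting bound on the complement gives the
  second one.\<close>

lemma dominating_degree_bounds:
  fixes R :: "'a rel" and \<delta> :: "'a \<Rightarrow> nat"
  assumes R: "sparse R" "sym R" "R \<subseteq> V \<times> V" and V: "finite V"
    and \<delta>: "\<And>v. v \<in> V \<Longrightarrow> card (R `` {v}) = \<delta> v"
    and D: "D \<subseteq> V" "\<And>v. v \<in> V - D \<Longrightarrow> \<exists>u \<in> D. (v, u) \<in> R"
  shows "card (V - D) \<le> sum \<delta> D"
    and "sum \<delta> V \<le> 2 * (sum \<delta> D + (card {v \<in> V - D. 2 \<le> \<delta> v} - 1))"
proof -
  let ?Y = "V - D"
  let ?H = "{v \<in> ?Y. 2 \<le> \<delta> v}"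
  have symR: "(a, b) \<in> R \<Longrightarrow> (b, a) \<in> R" for a b using R(2) by (auto dest: symD)
  have finR: "finite R" using R(3) V by (auto intro: finite_subset)
  have sum: "sum \<delta> S = card (R \<inter> S \<times> V)" if "S \<subseteq> V" for S
  proof -
    have "sum \<delta> S = (\<Sum>v\<in>S. card (R `` {v}))" using \<delta> that by (intro sum.cong) auto
    then show ?thesis using sum_card_Image_eq[OF V R(3) that] by simp
  qed
  have DY: "card (R \<inter> D \<times> ?Y) \<le> sum \<delta> D"
    using sum[OF D(1)] finR by (auto intro: card_mono)
  have YD: "card (R \<inter> ?Y \<times> D) = card (R \<inter> D \<times> ?Y)"
  proof -
    have "R \<inter> ?Y \<times> D = (R \<inter> D \<times> ?Y)\<inverse>" using symR by auto
    then show ?thesis by simp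
  qed
  have "?Y = fst ` (R \<inter> ?Y \<times> D)" using D(2) by force
  then have "card ?Y \<le> card (R \<inter> ?Y \<times> D)" using finR by (metis card_image_le finite_Int)
  with DY YD show "card ?Y \<le> sum \<delta> D" by linarith
  have "R \<inter> ?Y \<times> ?Y \<subseteq> R \<inter> ?H \<times> ?H"
  proof -
    have heavy: "2 \<le> \<delta> v" if vw: "v \<in> ?Y" "w \<in> ?Y" "(v, w) \<in> R" for v w
    proof -
      obtain u where "u \<in> D" "(v, u) \<in> R" using D(2)[OF vw(1)] by blast
      then have "{u, w} \<subseteq> R `` {v}" "u \<noteq> w" using vw by auto
      moreover have "finite (R `` {v})" using R(3) V by (auto intro: finite_subset[of _ V])
      ultimately have "card {u, w} \<le> card (R `` {v})" by (intro card_mono)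
      with \<open>u \<noteq> w\<close> have "2 \<le> card (R `` {v})" by simp
      then show ?thesis using \<delta> vw(1) by simp
    qed
    then show ?thesis using symR by blast
  qed
  then have "card (R \<inter> ?Y \<times> ?Y) \<le> card (R \<inter> ?H \<times> ?H)" using finR by (intro card_mono) auto
  moreover have "card (R \<inter> ?H \<times> ?H) \<le> 2 * (card ?H - 1)"
  proof (cases "?H = {}")
    case False
    then show ?thesis using sparseD[OF R(1), of ?H] V by auto
  next
    case True
    show ?thesis unfolding True by simp
  qed
  moreover have "sum \<delta> ?Y = card (R \<inter> ?Y \<times> D) + card (R \<inter> ?Y \<times> ?Y)"
  proof -
    have "R \<inter> ?Y \<times> V = (R \<inter> ?Y \<times> D) \<union> (R \<inter> ?Y \<times> ?Y)" using D(1) by auto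
    moreover have "card \<dots> = card (R \<inter> ?Y \<times> D) + card (R \<inter> ?Y \<times> ?Y)"
      using finR by (intro card_Un_disjoint) auto
    ultimately show ?thesis using sum[of ?Y] by simp
  qed
  moreover have "sum \<delta> V = sum \<delta> D + sum \<delta> ?Y" using sum.subset_diff[OF D(1) V, of \<delta>] by simp
  ultimately have "sum \<delta> V \<le> 2 * sum \<delta> D + 2 * (card ?H - 1)" using DY YD by linarith
  then show "sum \<delta> V \<le> 2 * (sum \<delta> D + (card ?H - 1))" by simp
qed

section \<open>From arbitrary index sets to prefixes\<close>

text \<open>\<open>I\<close> and the prefix of the same size have equally many elements outside each
  other, and the value \<open>f (card I)\<close> separates the values on these two
  differences.\<close>

lemma sum_le_sum_prefix:
  fixes f :: "nat \<Rightarrow> nat"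
  assumes anti: "\<And>i j. 1 \<le> i \<Longrightarrow> i \<le> j \<Longrightarrow> j \<le> n \<Longrightarrow> f j \<le> f i" and I: "I \<subseteq> {1..n}"
  shows "sum f I \<le> sum f {1..card I}"
proof -
  let ?k = "card I" and ?P = "{1..card I}"
  have fin: "finite I" using I by (rule finite_subset) simp
  have "card I \<le> n" using card_mono[OF _ I] by simp
  have cards: "card (I - ?P) = card (?P - I)"
    using card_Int_Diff[OF fin, of ?P] card_Int_Diff[of ?P I] by (simp add: Int_commute)
  have "sum f (I - ?P) \<le> card (I - ?P) * f ?k"
  proof (cases "I - ?P = {}")
    case False
    then have "?k \<ge> 1" using fin by (auto simp: Suc_le_eq card_gt_0_iff)
    have "sum f (I - ?P) \<le> of_nat (card (I - ?P)) * f ?k"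
    proof (rule sum_bounded_above)
      fix i assume "i \<in> I - ?P"
      then have "?k \<le> i" "i \<le> n" using I by auto
      then show "f i \<le> f ?k" using anti \<open>?k \<ge> 1\<close> by blast
    qed
    then show ?thesis by simp
  next
    case True
    show ?thesis unfolding True by simp
  qed
  also have "\<dots> \<le> sum f (?P - I)"
  proof -
    have "of_nat (card (?P - I)) * f ?k \<le> sum f (?P - I)"
      by (rule sum_bounded_below) (use anti \<open>card I \<le> n\<close> in auto)
    then show ?thesis using cards by simp
  qed
  finally have "sum f (I - ?P) \<le> sum f (?P - I)" .
  then show ?thesis
    using sum.Int_Diff[OF fin, of f ?P] sum.Int_Diff[of ?P f I] by (simp add: Int_commute)
qed

text \<open>The two inequalities of \<open>dominating_degree_bounds\<close> for the first
  \<open>k\<close> indices. The truncated subtraction covers the case that no index beyond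
  \<open>k\<close> has degree at least two.\<close>

definition prefix_dominable :: "nat \<Rightarrow> (nat \<Rightarrow> nat) \<Rightarrow> nat \<Rightarrow> bool" where
  "prefix_dominable n d k \<longleftrightarrow> n - k \<le> sum d {1..k} \<and>
     sum d {1..n} \<le> 2 * (sum d {1..k} + (card {i \<in> {k<..n}. 2 \<le> d i} - 1))"

text \<open>Enlarging the degree sum of the set may cost indices of degree at least two outside it.
  Up to a constant, the two terms together are the sum over the set of \<open>d i\<close> reduced by
  one when \<open>2 \<le> d i\<close>, which is still non-increasing in \<open>i\<close>, so the
  prefix is again the best choice.\<close>

lemma prefix_dominable_of_index_set:
  assumes anti: "\<And>i j. 1 \<le> i \<Longrightarrow> i \<le> j \<Longrightarrow> j \<le> n \<Longrightarrow> d j \<le> d i" and I: "I \<subseteq> {1..n}"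
    and le: "n - card I \<le> sum d I"
      "sum d {1..n} \<le> 2 * (sum d I + (card {i \<in> {1..n} - I. 2 \<le> d i} - 1))"
  shows "prefix_dominable n d (card I)"
proof -
  let ?k = "card I"
  let ?h = "\<lambda>i. if 2 \<le> d i then 1 else (0::nat)"
  let ?f = "\<lambda>i. d i - ?h i"
  have "?k \<le> n" using card_mono[OF _ I] by simp
  have "sum d I \<le> sum d {1..?k}" by (rule sum_le_sum_prefix[OF anti I])
  moreover have "sum d J + card {i \<in> {1..n} - J. 2 \<le> d i}
      = sum ?f J + card {i \<in> {1..n}. 2 \<le> d i}" if "J \<subseteq> {1..n}" for J
  proof -
    have fin: "finite J" using that by (rule finite_subset) simp
    have "sum d J = sum ?f J + sum ?h J" by (subst sum.distrib[symmetric]) (auto intro!: sum.cong)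
    moreover have "sum ?h J = card {i \<in> J. 2 \<le> d i}"
      using fin by (simp add: sum.If_cases Int_def)
    moreover have "{i \<in> {1..n}. 2 \<le> d i} = {i \<in> J. 2 \<le> d i} \<union> {i \<in> {1..n} - J. 2 \<le> d i}"
      using that by auto
    then have "card {i \<in> {1..n}. 2 \<le> d i} = card {i \<in> J. 2 \<le> d i} + card {i \<in> {1..n} - J. 2 \<le> d i}"
      using fin by (simp only:) (intro card_Un_disjoint, auto)
    ultimately show ?thesis by linarith
  qed
  note split = this
  have "sum ?f I \<le> sum ?f {1..?k}"
  proof (rule sum_le_sum_prefix[OF _ I])
    fix i j assume "1 \<le> i" "i \<le> j" "j \<le> n"
    then have "d j \<le> d i" by (rule anti)
    then show "?f j \<le> ?f i" by auto
  qed
  moreover have "{i \<in> {1..n} - {1..?k}. 2 \<le> d i} = {i \<in> {?k<..n}. 2 \<le> d i}" by auto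
  ultimately have "sum d I + card {i \<in> {1..n} - I. 2 \<le> d i}
      \<le> sum d {1..?k} + card {i \<in> {?k<..n}. 2 \<le> d i}"
    using split[OF I] split[of "{1..?k}"] \<open>?k \<le> n\<close> by simp
  \<comment> \<open>If no index of degree at least two lies outside \<open>I\<close>, the truncated
    term vanishes and the comparison of the plain degree sums is what gives the second
    inequality.\<close>
  with le \<open>sum d I \<le> _\<close> show ?thesis unfolding prefix_dominable_def by (auto split: nat_diff_split)
qed

text \<open>The bounds for \<open>D\<close> are pulled back along the enumeration \<open>u\<close>
  to the set \<open>I\<close> of its indices. This is the lower bound on the domination number of
  every forest with these degrees.\<close>

lemma prefix_dominable_of_dominating_set:
  assumes anti: "\<And>i j. 1 \<le> i \<Longrightarrow> i \<le> j \<Longrightarrow> j \<le> n \<Longrightarrow> d j \<le> d i"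
    and F: "F \<in> forests n d" and D: "dominating_set (with_proj F) D"
  shows "prefix_dominable n d (card D)"
proof -
  let ?R = "parcs F"
  from F obtain u where forest: "undirected_forest (with_proj F)"
    and u: "bij_betw u {1..n} (pverts F)" "\<And>i. i \<in> {1..n} \<Longrightarrow> card (?R `` {u i}) = d i"
    unfolding forests_def degree_sequence_via_def out_degree_with_proj by auto
  from forest have "graph (with_proj F)" by (simp add: undirected_forest_def)
  then interpret F: pair_graph F by (rule pair_graphI_graph)
  let ?V = "pverts F" and ?\<delta> = "\<lambda>v. card (?R `` {v})"
  have sub: "?R \<subseteq> ?V \<times> ?V" using F.arc_fst_in_verts F.arc_snd_in_verts by fastforce
  have symR: "sym ?R" using F.arcs_symmetric by (auto simp: sym_def)
  have D': "D \<subseteq> ?V" "\<And>v. v \<in> ?V - D \<Longrightarrow> \<exists>w \<in> D. (v, w) \<in> ?R"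
    using D by (auto simp: dominating_set_def)
  note bounds = dominating_degree_bounds[of ?R ?V ?\<delta> D,
      OF undirected_forest_imp_sparse[OF forest] symR sub F.pair_finite_verts refl D']
  define I where "I = {i \<in> {1..n}. u i \<in> D}"
  have inj: "inj_on u {1..n}" and img: "u ` {1..n} = ?V" using u(1) by (auto simp: bij_betw_def)
  have "u ` I = u ` {1..n} \<inter> D" "u ` ({1..n} - I) = u ` {1..n} - D"
    unfolding I_def by blast+
  then have I: "I \<subseteq> {1..n}" "u ` I = D" "u ` ({1..n} - I) = ?V - D"
    unfolding img using D'(1) by (auto simp: I_def)
  have sums: "sum ?\<delta> (u ` J) = sum d J" "card (u ` J) = card J" if "J \<subseteq> {1..n}" for J
  proof -
    have injJ: "inj_on u J" using inj that by (rule inj_on_subset)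
    have "sum ?\<delta> (u ` J) = sum (?\<delta> \<circ> u) J" using injJ by (rule sum.reindex)
    also have "\<dots> = sum d J" using that u(2) by (intro sum.cong) auto
    finally show "sum ?\<delta> (u ` J) = sum d J" .
    show "card (u ` J) = card J" using injJ by (rule card_image)
  qed
  have H: "{v \<in> ?V - D. 2 \<le> ?\<delta> v} = u ` {i \<in> {1..n} - I. 2 \<le> d i}"
    using u(2) by (auto simp flip: I(3))
  have cD: "card D = card I" using sums(2)[OF I(1)] I(2) by simp
  have cV: "card (?V - D) = n - card I"
  proof -
    have "card (?V - D) = card ({1..n} - I)" using sums(2)[of "{1..n} - I"] I(3) by auto
    then show ?thesis using I(1) by (simp add: card_Diff_subset finite_subset)
  qed
  have "card {v \<in> ?V - D. 2 \<le> ?\<delta> v} = card {i \<in> {1..n} - I. 2 \<le> d i}"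
    unfolding H by (rule sums(2)) auto
  moreover have "sum ?\<delta> ?V = sum d {1..n}" using sums(1)[of "{1..n}"] img by simp
  moreover have "sum ?\<delta> D = sum d I" using sums(1)[OF I(1)] I(2) by simp
  ultimately have "n - card I \<le> sum d I"
    "sum d {1..n} \<le> 2 * (sum d I + (card {i \<in> {1..n} - I. 2 \<le> d i} - 1))"
    using bounds cV by simp_all
  with anti I(1) show ?thesis unfolding cD by (rule prefix_dominable_of_index_set)
qed

section \<open>The inequalities at half of the length\<close>

lemma sum_split_prefix:
  fixes f :: "nat \<Rightarrow> nat"
  assumes "k \<le> n" shows "sum f {1..n} = sum f {1..k} + sum f {k<..n}"
proof -
  have "{1..n} = {1..k} \<union> {k<..n}" using assms by auto
  then show ?thesis by (simp only:) (rule sum.union_disjoint, auto)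
qed

text \<open>The degree sum of the first half is at least that of the rest. For even \<open>n\<close>
  this follows by pairing indices at distance \<open>n div 2\<close>. For odd \<open>n\<close> the
  rest has one index more, which is compensated either because all its degrees are one or because
  the last two are.\<close>

lemma prefix_dominable_half:
  assumes anti: "\<And>i j. 1 \<le> i \<Longrightarrow> i \<le> j \<Longrightarrow> j \<le> n \<Longrightarrow> d j \<le> d i"
    and pos: "\<And>i. i \<in> {1..n} \<Longrightarrow> 1 \<le> d i"
    and even: "even (sum d {1..n})" and le: "sum d {1..n} + 2 \<le> 2 * n"
  shows "prefix_dominable n d (n div 2)"
proof -
  define m where "m = n div 2"
  have "n \<noteq> 0" using le by auto
  have card_le: "card J \<le> sum d J" if "J \<subseteq> {1..n}" for J
  proof -
    have "sum (\<lambda>_. 1) J \<le> sum d J" using pos that by (intro sum_mono) auto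
    then show ?thesis by simp
  qed
  \<comment> \<open>Otherwise all degrees are one, and an odd number of ones has an odd sum.\<close>
  have d1: "1 < d 1" if "odd n"
  proof (rule ccontr)
    assume "\<not> 1 < d 1"
    then have "d i = 1" if "i \<in> {1..n}" for i using anti[of 1 i] pos[OF that] that by auto
    then have "sum d {1..n} = (\<Sum>i=1..n. 1)" by (intro sum.cong) auto
    with even that show False by simp
  qed
  have "n \<noteq> 1" using card_le[of "{1..n}"] le by auto
  with \<open>n \<noteq> 0\<close> have "1 \<le> m" by (simp add: m_def)
  have a: "n - m \<le> sum d {1..m}"
  proof (cases "even n")
    case True
    then show ?thesis using card_le[of "{1..m}"] by (auto simp: m_def)
  next
    case False
    have "sum d {1..m} = d 1 + sum d {1<..m}" using sum_split_prefix[OF \<open>1 \<le> m\<close>, of d] by simp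
    moreover have "card {1<..m} \<le> sum d {1<..m}" by (rule card_le) (auto simp: m_def)
    moreover have "n - m = m + 1" using False by (auto simp: m_def elim!: oddE)
    ultimately show ?thesis using d1[OF False] \<open>1 \<le> m\<close> by simp
  qed
  have "sum d {m<..n} \<le> sum d {1..m}"
  proof (cases "even n")
    case True
    then have n: "n = m + m" by (auto simp: m_def elim!: evenE)
    have "{m<..n} = {1 + m..m + m}" using n by auto
    then have "sum d {m<..n} = (\<Sum>i=1..m. d (i + m))" by (simp only: sum.shift_bounds_cl_nat_ivl)
    also have "\<dots> \<le> sum d {1..m}" using n by (intro sum_mono anti) auto
    finally show ?thesis .
  next
    case False
    then have n: "n = 2 * m + 1" by (auto simp: m_def elim!: oddE)
    show ?thesis
    proof (cases "d (m + 1) = 1")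
      case True
      have "d i = 1" if "i \<in> {m<..n}" for i
        using anti[of "m + 1" i] pos[of i] True that by auto
      then have "sum d {m<..n} = (\<Sum>i\<in>{m<..n}. 1)" by (intro sum.cong) auto
      then show ?thesis using a by simp
    next
      case False
      then have t: "2 \<le> d (m + 1)" using pos[of "m + 1"] n by auto
      \<comment> \<open>Otherwise the sum is at least \<open>2 * (n - 1) + 1\<close>, above the
        allowed \<open>2 * n - 2\<close>.\<close>
      have leaf: "d (n - 1) = 1"
      proof (rule ccontr)
        assume "d (n - 1) \<noteq> 1"
        then have "2 \<le> d (n - 1)" using pos[of "n - 1"] n \<open>1 \<le> m\<close> by auto
        then have "2 \<le> d i" if "i \<in> {1..n - 1}" for i using anti[of i "n - 1"] that by auto
        then have "(\<Sum>i=1..n - 1. 2) \<le> sum d {1..n - 1}" by (intro sum_mono)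
        moreover have "sum d {1..n} = sum d {1..n - 1} + sum d {n - 1<..n}"
          by (rule sum_split_prefix) simp
        moreover have "card {n - 1<..n} \<le> sum d {n - 1<..n}" by (rule card_le) (use n in auto)
        ultimately show False using le n by simp
      qed
      have "d n = 1" using anti[of "n - 1" n] pos[of n] leaf n \<open>1 \<le> m\<close> by auto
      have "m \<noteq> 1"
      proof
        assume "m = 1"
        then have "n - 1 = m + 1" using n by simp
        then show False using leaf t by (simp only:)
      qed
      with \<open>1 \<le> m\<close> obtain j where j: "m = j + 2" using le_Suc_ex[of 2 m] by auto
      \<comment> \<open>The middle range is paired with the first \<open>j\<close> indices. Of the
        two indices left in the first half, one outweighs \<open>m + 1\<close>, and the other, of
        degree at least two, outweighs the two leaves.\<close>
      have "{m<..n} = {m + 1, n - 1, n} \<union> {1 + (m + 1)..j + (m + 1)}" using n j by auto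
      then have "sum d {m<..n} = sum d {m + 1, n - 1, n} + sum d {1 + (m + 1)..j + (m + 1)}"
        using n j by (simp only:) (rule sum.union_disjoint, auto)
      moreover have "sum d {m + 1, n - 1, n} = d (m + 1) + (d (n - 1) + d n)" using n j by simp
      moreover have "sum d {1 + (m + 1)..j + (m + 1)} = (\<Sum>i=1..j. d (i + (m + 1)))"
        by (rule sum.shift_bounds_cl_nat_ivl)
      moreover have "\<dots> \<le> sum d {1..j}" using n j by (intro sum_mono anti) auto
      moreover have "{1..m} = {1..j} \<union> {j + 1, j + 2}" using j by auto
      then have "sum d {1..m} = sum d {1..j} + (d (j + 1) + d (j + 2))"
        by (simp add: sum.union_disjoint)
      moreover have "d (m + 1) \<le> d (j + 1)" "d (m + 1) \<le> d (j + 2)" using n j by (auto intro: anti)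
      ultimately show ?thesis using t leaf \<open>d n = 1\<close> by linarith
    qed
  qed
  moreover have "sum d {1..n} = sum d {1..m} + sum d {m<..n}"
    by (rule sum_split_prefix) (simp add: m_def)
  ultimately have "sum d {1..n} \<le> 2 * (sum d {1..m} + (card {i \<in> {m<..n}. 2 \<le> d i} - 1))" by simp
  with a show ?thesis by (simp add: prefix_dominable_def m_def)
qed

section \<open>Construction of the forest\<close>

text \<open>Greedy choice: the new element takes the least value for which the upper bounds of the
  other elements can still supply the rest of \<open>s\<close>.\<close>

lemma exists_sum_between:
  fixes l h :: "'a \<Rightarrow> nat"
  assumes "finite A" "\<And>a. a \<in> A \<Longrightarrow> l a \<le> h a" "sum l A \<le> s" "s \<le> sum h A"
  shows "\<exists>e. (\<forall>a \<in> A. l a \<le> e a \<and> e a \<le> h a) \<and> sum e A = s"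
  using assms
proof (induction A arbitrary: s rule: finite_induct)
  case (insert a A)
  define t where "t = max (l a) (s - sum h A)"
  have "sum l A \<le> sum h A" using insert.prems(1) by (auto intro: sum_mono)
  moreover have "l a \<le> h a" using insert.prems(1) by simp
  moreover have "l a + sum l A \<le> s" "s \<le> h a + sum h A" using insert by auto
  ultimately have t: "l a \<le> t" "t \<le> h a" "t \<le> s" "sum l A \<le> s - t" "s - t \<le> sum h A"
    by (auto simp: t_def)
  obtain e where e: "\<forall>b \<in> A. l b \<le> e b \<and> e b \<le> h b" "sum e A = s - t"
    using insert.IH[OF _ t(4,5)] insert.prems(1) by auto
  let ?e = "e(a := t)"
  have "sum ?e A = sum e A" using insert.hyps by (intro sum.cong) auto
  then have "sum ?e (insert a A) = s" using insert.hyps e(2) t(3) by simp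
  moreover have "\<forall>b \<in> insert a A. l b \<le> ?e b \<and> ?e b \<le> h b" using e(1) t by simp
  ultimately show ?case by blast
qed simp

text \<open>The indices with \<open>2 \<le> d i\<close> form a prefix of the interval, of size
  \<open>q\<close>. The sum \<open>s\<close> is spread over the first \<open>min s q\<close> of
  them, with values from one to \<open>d i - 1\<close>, so that every vertex keeps an edge to the
  other side.\<close>

lemma exists_internal_degrees:
  fixes d :: "nat \<Rightarrow> nat"
  assumes anti: "\<And>i j. a < i \<Longrightarrow> i \<le> j \<Longrightarrow> j \<le> b \<Longrightarrow> d j \<le> d i"
    and pos: "\<And>i. i \<in> {a<..b} \<Longrightarrow> 1 \<le> d i"
    and s: "s \<le> (\<Sum>i\<in>{a<..b}. d i - 1)" "s \<le> 2 * (card {i \<in> {a<..b}. 2 \<le> d i} - 1)"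
    and "even s" "a \<le> b"
  shows "\<exists>e p. (\<forall>i \<in> {a<..b}. e i + 1 \<le> d i) \<and> sum e {a<..b} = s \<and> a \<le> p \<and> p \<le> b
    \<and> {i \<in> {a<..b}. 1 \<le> e i} = {a<..p} \<and> (s div 2 = 0 \<or> s div 2 + 1 \<le> card {i \<in> {a<..b}. 1 \<le> e i})"
proof -
  let ?H = "{i \<in> {a<..b}. 2 \<le> d i}"
  define q where "q = card ?H"
  have "card ?H \<le> card {a<..b}" by (rule card_mono) auto
  then have "q \<le> b - a" by (simp add: q_def)
  have H: "?H = {a<..a + q}"
  proof -
    have "i \<in> ?H \<longleftrightarrow> i \<le> a + q" if i: "i \<in> {a<..b}" for i
    proof
      assume "i \<in> ?H"
      have "{a<..i} \<subseteq> ?H"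
      proof
        fix j assume j: "j \<in> {a<..i}"
        then have "d i \<le> d j" using anti i by auto
        then show "j \<in> ?H" using j i \<open>i \<in> ?H\<close> by auto
      qed
      from card_mono[OF _ this] have "i - a \<le> q" by (simp add: q_def)
      then show "i \<le> a + q" by linarith
    next
      assume "i \<le> a + q"
      show "i \<in> ?H"
      proof (rule ccontr)
        assume n: "i \<notin> ?H"
        have "?H \<subseteq> {a<..<i}"
        proof
          fix j assume j: "j \<in> ?H"
          have "j < i"
          proof (rule ccontr)
            assume "\<not> j < i"
            then have "d j \<le> d i" using anti i j by auto
            then show False using n j i by auto
          qed
          then show "j \<in> {a<..<i}" using j by auto
        qed
        from card_mono[OF _ this] have "q \<le> i - a - 1" by (simp add: q_def)
        then show False using \<open>i \<le> a + q\<close> i by auto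
      qed
    qed
    then show ?thesis using \<open>q \<le> b - a\<close> \<open>a \<le> b\<close> by (auto simp del: mem_Collect_eq) auto
  qed
  \<comment> \<open>Spread the demand over as many vertices as possible: only then is a forest possible.\<close>
  define p where "p = min s q"
  let ?Q = "{a<..a + p}"
  have QH: "?Q \<subseteq> ?H" unfolding H by (auto simp: p_def)
  \<comment> \<open>Either the prefix consists of \<open>s\<close> vertices with room for at least
    one each, or it contains all vertices of degree at least two, and the others contribute zero to
    the sum of \<open>d i - 1\<close>.\<close>
  have up: "s \<le> (\<Sum>i\<in>?Q. d i - 1)"
  proof (cases "s \<le> q")
    case True
    have "(\<Sum>i\<in>?Q. 1) \<le> (\<Sum>i\<in>?Q. d i - 1)" using QH by (intro sum_mono) auto
    then show ?thesis using True by (simp add: p_def)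
  next
    case False
    then have "?Q = ?H" unfolding H by (simp add: p_def)
    moreover have "(\<Sum>i\<in>?H. d i - 1) = (\<Sum>i\<in>{a<..b}. d i - 1)"
      by (rule sum.mono_neutral_left) (auto simp: not_le)
    ultimately show ?thesis using s(1) by simp
  qed
  have "\<exists>e. (\<forall>i \<in> ?Q. 1 \<le> e i \<and> e i \<le> d i - 1) \<and> sum e ?Q = s"
  proof (rule exists_sum_between)
    show "(\<Sum>i\<in>?Q. 1) \<le> s" by (simp add: p_def)
    show "1 \<le> d i - 1" if "i \<in> ?Q" for i using that QH by auto
  qed (use up in auto)
  then obtain e0 where e0: "\<And>i. i \<in> ?Q \<Longrightarrow> 1 \<le> e0 i \<and> e0 i \<le> d i - 1" "sum e0 ?Q = s" by blast
  define e where "e i = (if i \<in> ?Q then e0 i else 0)" for i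
  have Qsub: "?Q \<subseteq> {a<..b}" using QH by auto
  have supp: "{i \<in> {a<..b}. 1 \<le> e i} = ?Q" using e0(1) Qsub by (auto simp: e_def)
  have "sum e {a<..b} = sum e ?Q" by (rule sum.mono_neutral_right) (use Qsub in \<open>auto simp: e_def\<close>)
  also have "\<dots> = s" using e0(2) by (simp add: e_def)
  finally have "sum e {a<..b} = s" .
  moreover have "e i + 1 \<le> d i" if "i \<in> {a<..b}" for i
  proof (cases "i \<in> ?Q")
    case True
    then have "2 \<le> d i" using QH by auto
    moreover have "e0 i \<le> d i - 1" using e0(1)[OF True] by blast
    ultimately have "e0 i + 1 \<le> d i" by linarith
    then show ?thesis using True unfolding e_def by simp
  next
    case False
    then have "e i = 0" by (simp only: e_def if_False)
    then show ?thesis using pos[OF that] by simp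
  qed
  \<comment> \<open>For positive even \<open>s\<close>, both \<open>s\<close> and \<open>q\<close>
    are at least \<open>s div 2 + 1\<close>, the latter by the second bound on
    \<open>s\<close>.\<close>
  moreover have "s div 2 = 0 \<or> s div 2 + 1 \<le> card {i \<in> {a<..b}. 1 \<le> e i}"
  proof -
    have "s \<le> 2 * (q - 1)" using s(2) by (simp add: q_def)
    then show ?thesis unfolding supp using \<open>even s\<close> by (auto simp: p_def elim!: evenE)
  qed
  moreover have "a + p \<le> b" using \<open>q \<le> b - a\<close> \<open>a \<le> b\<close> by (simp add: p_def)
  ultimately show ?thesis using supp by (intro exI[of _ e] exI[of _ "a + p"]) auto
qed

text \<open>Serves both cases of the construction: \<open>X\<close> becomes independent, and the
  interval \<open>Y\<close>, whose ends are \<open>a\<close> and \<open>b\<close>, absorbs its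
  excess \<open>s\<close> of degree by internal edges. Every vertex keeps a cross edge, so each side
  dominates the other; since the internal degrees are supported on a prefix of \<open>Y\<close>, its
  isolated vertices form a suffix.\<close>

lemma forest_independent_side:
  fixes d :: "nat \<Rightarrow> nat" and a b :: nat and Y :: "nat set"
  assumes Y_def: "Y = {a<..b}"
  assumes X: "finite X" "X \<inter> Y = {}" and pos: "\<And>i. i \<in> X \<union> Y \<Longrightarrow> 1 \<le> d i"
    and anti: "\<And>i j. a < i \<Longrightarrow> i \<le> j \<Longrightarrow> j \<le> b \<Longrightarrow> d j \<le> d i"
    and s: "s \<le> (\<Sum>i\<in>Y. d i - 1)" "s \<le> 2 * (card {i \<in> Y. 2 \<le> d i} - 1)" "even s"
    and "a \<le> b" "sum d X + s = sum d Y" "sum d X + s div 2 + 1 \<le> card X + card Y"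
  shows "\<exists>R p. sym R \<and> sparse R \<and> R \<subseteq> (X \<union> Y) \<times> (X \<union> Y) \<and> (\<forall>v \<in> X \<union> Y. card (R `` {v}) = d v)
    \<and> R \<inter> X \<times> X = {} \<and> (\<forall>v \<in> X. \<exists>w \<in> Y. (v, w) \<in> R) \<and> (\<forall>v \<in> Y. \<exists>w \<in> X. (v, w) \<in> R)
    \<and> a \<le> p \<and> p \<le> b \<and> {v \<in> Y. R `` {v} \<inter> Y = {}} = {p<..b}"
proof -
  have finY: "finite Y" by (simp add: Y_def)
  have "\<exists>e p. (\<forall>i \<in> Y. e i + 1 \<le> d i) \<and> sum e Y = s \<and> a \<le> p \<and> p \<le> b
    \<and> {i \<in> Y. 1 \<le> e i} = {a<..p} \<and> (s div 2 = 0 \<or> s div 2 + 1 \<le> card {i \<in> Y. 1 \<le> e i})"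
    using anti pos s \<open>a \<le> b\<close> unfolding Y_def by (intro exists_internal_degrees) auto
  then obtain e p where e: "\<And>i. i \<in> Y \<Longrightarrow> e i + 1 \<le> d i" "sum e Y = s" "a \<le> p" "p \<le> b"
    "{i \<in> Y. 1 \<le> e i} = {a<..p}" "s div 2 = 0 \<or> s div 2 + 1 \<le> card {i \<in> Y. 1 \<le> e i}"
    by blast
  define c where "c v = (if v \<in> Y then d v - e v else d v)" for v
  have cY: "c v + e v = d v" "1 \<le> c v" if "v \<in> Y" for v using e(1)[OF that] that by (auto simp: c_def)
  have cX: "c v = d v" if "v \<in> X" for v using that X(2) by (auto simp: c_def)
  have "sum c Y + sum e Y = sum d Y" using cY(1) by (simp add: sum.distrib[symmetric])
  moreover have sX: "sum c X = sum d X" using cX by (rule sum.cong[OF refl])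
  ultimately have "sum c X = sum c Y" using assms(10) e(2) by linarith
  moreover have "sum e Y = 2 * (s div 2)" using e(2) s(3) by simp
  moreover have "sum c X + s div 2 + 1 \<le> card X + card Y" using sX assms(11) by simp
  moreover have "1 \<le> c v" if "v \<in> X \<union> Y" for v using cX cY pos[OF that] that by auto
  ultimately have "\<exists>R. sym R \<and> sparse R \<and> R \<subseteq> (X \<union> Y) \<times> (X \<union> Y)
    \<and> (\<forall>v \<in> X. R `` {v} \<subseteq> Y \<and> card (R `` {v}) = c v)
    \<and> (\<forall>v \<in> Y. card (R `` {v} \<inter> X) = c v \<and> card (R `` {v} \<inter> Y) = e v)"
    using e(6) by (intro forest_realization[OF X(1) finY X(2)])
  then obtain R where R: "sym R" "sparse R" "R \<subseteq> (X \<union> Y) \<times> (X \<union> Y)"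
    "\<And>v. v \<in> X \<Longrightarrow> R `` {v} \<subseteq> Y" "\<And>v. v \<in> X \<Longrightarrow> card (R `` {v}) = c v"
    "\<And>v. v \<in> Y \<Longrightarrow> card (R `` {v} \<inter> X) = c v" "\<And>v. v \<in> Y \<Longrightarrow> card (R `` {v} \<inter> Y) = e v"
    by blast
  have "card (R `` {v}) = d v" if "v \<in> X \<union> Y" for v
  proof (cases "v \<in> X")
    case True
    then show ?thesis using R(5) cX by simp
  next
    case False
    then have v: "v \<in> Y" using that by simp
    have "R `` {v} = (R `` {v} \<inter> X) \<union> (R `` {v} \<inter> Y)" using R(3) by auto
    moreover have "card \<dots> = card (R `` {v} \<inter> X) + card (R `` {v} \<inter> Y)"
      using X finY by (intro card_Un_disjoint) auto
    ultimately show ?thesis using R(6,7)[OF v] cY(1)[OF v] by simp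
  qed
  moreover have "R \<inter> X \<times> X = {}" using R(4) X(2) by auto
  moreover have "\<exists>w \<in> Y. (v, w) \<in> R" if "v \<in> X" for v
  proof -
    have "R `` {v} \<noteq> {}" using R(5)[OF that] cX[OF that] pos[of v] that by auto
    then show ?thesis using R(4)[OF that] by auto
  qed
  moreover have "\<exists>w \<in> X. (v, w) \<in> R" if "v \<in> Y" for v
  proof -
    have "R `` {v} \<inter> X \<noteq> {}" using R(6)[OF that] cY(2)[OF that] by auto
    then show ?thesis by auto
  qed
  moreover have "{v \<in> Y. R `` {v} \<inter> Y = {}} = {p<..b}"
  proof -
    have "R `` {v} \<inter> Y = {} \<longleftrightarrow> v \<notin> {i \<in> Y. 1 \<le> e i}" if "v \<in> Y" for v
    proof -
      have "R `` {v} \<inter> Y = {} \<longleftrightarrow> card (R `` {v} \<inter> Y) = 0" using finY by simp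
      then show ?thesis using R(7)[OF that] that by auto
    qed
    then have "{v \<in> Y. R `` {v} \<inter> Y = {}} = Y - {a<..p}" unfolding e(5) by blast
    also have "\<dots> = {p<..b}" using e(3,4) by (auto simp: Y_def)
    finally show ?thesis .
  qed
  ultimately show ?thesis using R(1-3) e(3,4) by (intro exI[of _ R] exI[of _ p]) blast
qed

text \<open>The side with the larger degree sum takes the role of \<open>Y\<close> in
  \<open>forest_independent_side\<close>. If this is the complement, the inequalities for
  \<open>k\<close> are exactly what is required; if it is the first \<open>k\<close> indices,
  minimality of \<open>k\<close> and \<open>k \<le> n div 2\<close> replace them.\<close>

lemma exists_forest_prefix_dominable:
  assumes anti: "\<And>i j. 1 \<le> i \<Longrightarrow> i \<le> j \<Longrightarrow> j \<le> n \<Longrightarrow> d j \<le> d i"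
    and pos: "\<And>i. i \<in> {1..n} \<Longrightarrow> 1 \<le> d i"
    and even: "even (sum d {1..n})" and le: "sum d {1..n} + 2 \<le> 2 * n"
    and k: "prefix_dominable n d k" "\<And>j. j < k \<Longrightarrow> \<not> prefix_dominable n d j" "k \<le> n div 2"
  obtains R p q where "sym R" "sparse R" "R \<subseteq> {1..n} \<times> {1..n}" "\<forall>v \<in> {1..n}. card (R `` {v}) = d v"
    "R \<inter> {1..k} \<times> {1..k} = {} \<or> R \<inter> {k<..n} \<times> {k<..n} = {}"
    "\<forall>v \<in> {1..k}. \<exists>w \<in> {k<..n}. (v, w) \<in> R" "\<forall>v \<in> {k<..n}. \<exists>w \<in> {1..k}. (v, w) \<in> R"
    "{v \<in> {1..k}. R `` {v} \<inter> {1..k} = {}} = {p<..k}"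
    "{v \<in> {k<..n}. R `` {v} \<inter> {k<..n} = {}} = {q<..n}" "p \<le> k" "k \<le> q" "q \<le> n"
proof -
  let ?X = "{1..k}" and ?Y = "{k<..n}"
  let ?a = "sum d ?X" and ?b = "sum d ?Y"
  have kn: "k \<le> n" using k(3) by simp
  have total: "sum d {1..n} = ?a + ?b" using kn by (rule sum_split_prefix)
  have V: "?X \<union> ?Y = {1..n}" "?Y \<union> ?X = {1..n}" using kn by auto
  have X0: "?X = {0<..k}" by auto
  have isoX: "{v \<in> S. R `` {v} \<inter> S = {}} = S" if "R \<inter> S \<times> S = {}" for R S :: "_ set"
    using that by auto
  have pred: "(\<Sum>i\<in>S. d i - 1) + card S = sum d S" if "S \<subseteq> {1..n}" for S
  proof -
    have "d i - 1 + 1 = d i" if "i \<in> S" for i using pos[of i] that \<open>S \<subseteq> {1..n}\<close> by auto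
    then have "(\<Sum>i\<in>S. d i - 1) + (\<Sum>i\<in>S. 1) = (\<Sum>i\<in>S. d i)"
      unfolding sum.distrib[symmetric] by (intro sum.cong) auto
    then show ?thesis by simp
  qed
  have A: "n - k \<le> ?a" and B: "?a + ?b \<le> 2 * ?a + 2 * (card {i \<in> ?Y. 2 \<le> d i} - 1)"
    using k(1) total unfolding prefix_dominable_def by simp_all
  have pY: "(\<Sum>i\<in>?Y. d i - 1) + (n - k) = ?b" using pred[of ?Y] by (simp add: subset_eq)
  show thesis
  proof (cases "?a \<le> ?b")
    case True
    define s where "s = ?b - ?a"
    have s: "?b = ?a + s" using True by (simp add: s_def)
    have "even s" using even total s by auto
    have "\<exists>R q. sym R \<and> sparse R \<and> R \<subseteq> (?X \<union> ?Y) \<times> (?X \<union> ?Y) \<and> (\<forall>v \<in> ?X \<union> ?Y. card (R `` {v}) = d v)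
      \<and> R \<inter> ?X \<times> ?X = {} \<and> (\<forall>v \<in> ?X. \<exists>w \<in> ?Y. (v, w) \<in> R) \<and> (\<forall>v \<in> ?Y. \<exists>w \<in> ?X. (v, w) \<in> R)
      \<and> k \<le> q \<and> q \<le> n \<and> {v \<in> ?Y. R `` {v} \<inter> ?Y = {}} = {q<..n}"
    proof (rule forest_independent_side[where s = s])
      \<comment> \<open>The right-hand side is \<open>?b - (n - k)\<close> and \<open>s\<close> is
        \<open>?b - ?a\<close>, so this is the first inequality for \<open>k\<close>.\<close>
      show "s \<le> (\<Sum>i\<in>?Y. d i - 1)" using A pY s by linarith
      show "s \<le> 2 * (card {i \<in> ?Y. 2 \<le> d i} - 1)" using B s by linarith
      \<comment> \<open>The left-hand side exceeds the number of edges, half of the total degree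
        sum, by one.\<close>
      show "?a + s div 2 + 1 \<le> card ?X + card ?Y"
        using le total s kn \<open>even s\<close> by (auto elim!: evenE)
      show "1 \<le> d i" if "i \<in> ?X \<union> ?Y" for i using pos that V by auto
      show "d j \<le> d i" if "k < i" "i \<le> j" "j \<le> n" for i j using anti that by auto
    qed (use s kn \<open>even s\<close> in auto)
    then obtain R q where R: "sym R" "sparse R" "R \<subseteq> {1..n} \<times> {1..n}" "\<forall>v \<in> {1..n}. card (R `` {v}) = d v"
      "R \<inter> ?X \<times> ?X = {}" "\<forall>v \<in> ?X. \<exists>w \<in> ?Y. (v, w) \<in> R" "\<forall>v \<in> ?Y. \<exists>w \<in> ?X. (v, w) \<in> R"
      "k \<le> q" "q \<le> n" "{v \<in> ?Y. R `` {v} \<inter> ?Y = {}} = {q<..n}"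
      unfolding V by blast
    have "{v \<in> ?X. R `` {v} \<inter> ?X = {}} = {0<..k}" using isoX[OF R(5)] X0 by (rule trans)
    with R show thesis by (intro that[of R 0 q]) blast+
  next
    case False
    define s where "s = ?a - ?b"
    have s: "?a = ?b + s" using False by (simp add: s_def)
    have "even s" using even total s by auto
    have "s \<noteq> 0" using False s by simp
    with \<open>even s\<close> have "2 \<le> s" by (cases "s = 1") auto
    have pX: "(\<Sum>i\<in>?X. d i - 1) + k = ?a" using pred[of ?X] kn by simp
    have bY: "n - k \<le> ?b" using pY by linarith
    have "k \<noteq> 0" using False by (cases k) auto
    \<comment> \<open>Otherwise vertex \<open>k\<close> is a leaf, and \<open>k - 1\<close> would be large enough already.\<close>
    have dk: "2 \<le> d k"
    proof (rule ccontr)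
      assume "\<not> 2 \<le> d k"
      then have "d k = 1" using pos[of k] kn \<open>k \<noteq> 0\<close> by auto
      then have one: "d i = 1" if "i \<in> ?Y" for i using anti[of k i] pos[of i] that \<open>k \<noteq> 0\<close> by auto
      have "?b = (\<Sum>i\<in>?Y. 1)" using one by (rule sum.cong[OF refl])
      then have b: "?b = n - k" by simp
      have "?a = sum d {1..k - 1} + d k" using \<open>k \<noteq> 0\<close> by (cases k) auto
      then have a: "?a = sum d {1..k - 1} + 1" using \<open>d k = 1\<close> by simp
      \<comment> \<open>Since \<open>?a = ?b + s\<close> with \<open>?b = n - k\<close> and
        \<open>2 \<le> s\<close>, both inequalities survive lowering \<open>?a\<close> by
        one.\<close>
      have "prefix_dominable n d (k - 1)"
        unfolding prefix_dominable_def using a b s total \<open>2 \<le> s\<close> by simp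
      then show False using k(2)[of "k - 1"] \<open>k \<noteq> 0\<close> by simp
    qed
    have "2 \<le> d i" if "i \<in> ?X" for i using anti[of i k] dk kn that by auto
    then have heavy: "{i \<in> ?X. 2 \<le> d i} = ?X" by blast
    have "\<exists>R p. sym R \<and> sparse R \<and> R \<subseteq> (?Y \<union> ?X) \<times> (?Y \<union> ?X) \<and> (\<forall>v \<in> ?Y \<union> ?X. card (R `` {v}) = d v)
      \<and> R \<inter> ?Y \<times> ?Y = {} \<and> (\<forall>v \<in> ?Y. \<exists>w \<in> ?X. (v, w) \<in> R) \<and> (\<forall>v \<in> ?X. \<exists>w \<in> ?Y. (v, w) \<in> R)
      \<and> 0 \<le> p \<and> p \<le> k \<and> {v \<in> ?X. R `` {v} \<inter> ?X = {}} = {p<..k}"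
    proof (rule forest_independent_side[where s = s])
      \<comment> \<open>The right-hand side is \<open>?a - k\<close>, and
        \<open>k \<le> n - k \<le> ?b\<close>.\<close>
      show "s \<le> (\<Sum>i\<in>?X. d i - 1)" using pX bY s k(3) by linarith
      \<comment> \<open>From \<open>?a + ?b \<le> 2 * n - 2\<close> and
        \<open>n - k \<le> ?b\<close> one gets \<open>?a - ?b \<le> 2 * (k - 1)\<close>.\<close>
      show "s \<le> 2 * (card {i \<in> ?X. 2 \<le> d i} - 1)"
        unfolding heavy using le total s bY kn \<open>k \<noteq> 0\<close> by auto
      show "?b + s div 2 + 1 \<le> card ?Y + card ?X"
        using le total s kn \<open>even s\<close> by (auto elim!: evenE)
      show "1 \<le> d i" if "i \<in> ?Y \<union> ?X" for i using pos that V by auto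
      show "d j \<le> d i" if "0 < i" "i \<le> j" "j \<le> k" for i j using anti that kn by auto
    qed (use s kn \<open>even s\<close> in auto)
    then obtain R p where R: "sym R" "sparse R" "R \<subseteq> {1..n} \<times> {1..n}" "\<forall>v \<in> {1..n}. card (R `` {v}) = d v"
      "R \<inter> ?Y \<times> ?Y = {}" "\<forall>v \<in> ?Y. \<exists>w \<in> ?X. (v, w) \<in> R" "\<forall>v \<in> ?X. \<exists>w \<in> ?Y. (v, w) \<in> R"
      "p \<le> k" "{v \<in> ?X. R `` {v} \<inter> ?X = {}} = {p<..k}"
      unfolding V by blast
    have "{v \<in> ?Y. R `` {v} \<inter> ?Y = {}} = {k<..n}" using R(5) by (rule isoX)
    with R kn show thesis by (intro that[of R p k]) blast+
  qed
qed

section \<open>Translation back to graphs and conclusion\<close>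

text \<open>Finiteness matters because the degree is a cardinality, which would also be zero for an
  infinite set of arcs.\<close>

lemma isolated_verts_induce_with_proj:
  assumes "finite (parcs F)"
  shows "isolated_verts (with_proj F \<restriction> D) = {v \<in> D. parcs F `` {v} \<inter> D = {}}"
proof -
  have "out_degree (with_proj F \<restriction> D) v = 0 \<longleftrightarrow> parcs F `` {v} \<inter> D = {}" if "v \<in> D" for v
  proof -
    have "out_arcs (with_proj F \<restriction> D) v = Pair v ` (parcs F `` {v} \<inter> D)"
      using that by (auto simp: out_arcs_def image_iff)
    moreover have "finite (parcs F `` {v} \<inter> D)"
      using assms by (auto intro: finite_subset[of _ "snd ` parcs F"] simp: image_iff)
    ultimately show ?thesis by (auto simp: out_degree_def)
  qed
  then show ?thesis by (auto simp: isolated_verts_def)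
qed

theorem theorem3:
  fixes n k :: nat and d :: "nat \<Rightarrow> nat"
  assumes noninc: "\<And>i j. 1 \<le> i \<Longrightarrow> i \<le> j \<Longrightarrow> j \<le> n \<Longrightarrow> d j \<le> d i"
    and pos: "\<And>i. i \<in> {1..n} \<Longrightarrow> 0 < d i"
    and even_sum: "even (\<Sum>i = 1..n. d i)"
    and sum_le: "int (\<Sum>i = 1..n. d i) \<le> 2 * int n - 2"
    and k: "min_forest_domination n d = k"
  shows "\<exists>(F :: nat pair_pre_digraph) (u :: nat \<Rightarrow> nat) D D'.
    undirected_forest F \<and> degree_sequence_via F n d u \<and>
    D = u ` {1..k} \<and> D' = u ` {k+1..n} \<and>
    dominating_set F D \<and> dominating_set F D' \<and>
    (independent_set F D \<or> independent_set F D') \<and>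
    (\<forall>r \<le> k. card (isolated_verts (F \<restriction> D)) = r \<longrightarrow>
       isolated_verts (F \<restriction> D) = u ` ({1..k} - {1..k - r})) \<and>
    (\<forall>s \<le> n - k. card (isolated_verts (F \<restriction> D')) = s \<longrightarrow>
       isolated_verts (F \<restriction> D') = u ` ({1..n} - {1..n - s}))"
proof -
  have pos': "\<And>i. i \<in> {1..n} \<Longrightarrow> 1 \<le> d i" using pos by (simp add: Suc_le_eq)
  have le: "sum d {1..n} + 2 \<le> 2 * n" using sum_le by linarith
  have half: "prefix_dominable n d (n div 2)"
    using noninc pos' even_sum le by (rule prefix_dominable_half)
  \<comment> \<open>This will be the minimum domination number: every forest needs at least
    \<open>m\<close> vertices, and the forest \<open>F\<close> below is dominated by its first
    \<open>m\<close>.\<close>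
  define m where "m = (LEAST j. prefix_dominable n d j)"
  have m: "prefix_dominable n d m" "m \<le> n div 2" "\<And>j. prefix_dominable n d j \<Longrightarrow> m \<le> j"
    unfolding m_def using half by (auto intro: LeastI Least_le)
  have "m \<le> n" using m(2) by simp
  have below: "\<not> prefix_dominable n d j" if "j < m" for j using m(3)[of j] that by auto
  obtain R p q where R: "sym R" "sparse R" "R \<subseteq> {1..n} \<times> {1..n}" "\<forall>v \<in> {1..n}. card (R `` {v}) = d v"
    "R \<inter> {1..m} \<times> {1..m} = {} \<or> R \<inter> {m<..n} \<times> {m<..n} = {}"
    "\<forall>v \<in> {1..m}. \<exists>w \<in> {m<..n}. (v, w) \<in> R" "\<forall>v \<in> {m<..n}. \<exists>w \<in> {1..m}. (v, w) \<in> R"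
    "{v \<in> {1..m}. R `` {v} \<inter> {1..m} = {}} = {p<..m}"
    "{v \<in> {m<..n}. R `` {v} \<inter> {m<..n} = {}} = {q<..n}" "p \<le> m" "m \<le> q" "q \<le> n"
    using noninc pos' even_sum le m(1) below m(2) by (rule exists_forest_prefix_dominable)
  \<comment> \<open>The vertices are the indices themselves, so the enumeration is
    \<open>id\<close>.\<close>
  define F where "F = \<lparr>pverts = {1..n}, parcs = R\<rparr>"
  have F: "pverts F = {1..n}" "parcs F = R" by (simp_all add: F_def)
  have finR: "finite R" using R(3) by (rule finite_subset) simp
  have forest: "undirected_forest (with_proj F)"
    unfolding F_def using R by (intro undirected_forestI) auto
  have via: "degree_sequence_via (with_proj F) n d id"
    using R(4) by (auto simp: degree_sequence_via_def out_degree_with_proj F)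
  have dom: "dominating_set (with_proj F) {1..m}" "dominating_set (with_proj F) {m<..n}"
    using R(6,7) \<open>m \<le> n\<close> by (auto simp: dominating_set_def F)
  have in_forests: "F \<in> forests n d" using forest via by (auto simp: forests_def)
  have lower: "m \<le> domination_number (with_proj G)" if "G \<in> forests n d" for G
  proof -
    let ?P = "\<lambda>j. \<exists>D. dominating_set (with_proj G) D \<and> card D = j"
    have "dominating_set (with_proj G) (verts (with_proj G))" by (simp add: dominating_set_def)
    then have "\<exists>j. ?P j" by blast
    then have "?P (domination_number (with_proj G))"
      unfolding domination_number_def by (rule LeastI_ex)
    then obtain D where "dominating_set (with_proj G) D" "card D = domination_number (with_proj G)"
      by blast
    moreover have "prefix_dominable n d (card D)"
      using noninc that \<open>dominating_set (with_proj G) D\<close> by (rule prefix_dominable_of_dominating_set)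
    ultimately show ?thesis using m(3) by metis
  qed
  have "domination_number (with_proj F) \<le> m"
    unfolding domination_number_def by (rule Least_le) (use dom(1) in auto)
  with lower[OF in_forests] have "domination_number (with_proj F) = m" by simp
  then have "min_forest_domination n d = m"
    unfolding min_forest_domination_def using in_forests lower by (intro Least_equality) auto
  with k have km: "k = m" by simp
  have iso: "isolated_verts (with_proj F \<restriction> {1..m}) = {p<..m}"
    "isolated_verts (with_proj F \<restriction> {m<..n}) = {q<..n}"
    using isolated_verts_induce_with_proj[of F] finR R(8,9) unfolding F by simp_all
  have ind: "independent_set (with_proj F) {1..m} \<or> independent_set (with_proj F) {m<..n}"
    using R(5) \<open>m \<le> n\<close> by (auto simp: independent_set_def F)
  \<comment> \<open>A suffix of \<open>{1..i}\<close> is determined by its size, so (iii) and (iv)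
    only require the isolated vertices to form suffixes.\<close>
  have suffix: "card {j<..i} = r \<longrightarrow> {j<..i} = id ` ({1..i} - {1..i - r})" if "j \<le> i" for i j r :: nat
    using that by auto
  have "{1..m} = id ` {1..k}" "{m<..n} = id ` {k + 1..n}" using km by auto
  moreover have "\<forall>r \<le> k. card (isolated_verts (with_proj F \<restriction> {1..m})) = r \<longrightarrow>
      isolated_verts (with_proj F \<restriction> {1..m}) = id ` ({1..k} - {1..k - r})"
    unfolding iso km using suffix[OF R(10)] by blast
  moreover have "\<forall>s \<le> n - k. card (isolated_verts (with_proj F \<restriction> {m<..n})) = s \<longrightarrow>
      isolated_verts (with_proj F \<restriction> {m<..n}) = id ` ({1..n} - {1..n - s})"
    unfolding iso using suffix[OF R(12)] by blast
  ultimately show ?thesis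
    using forest via dom ind
    by (intro exI[of _ F] exI[of _ id] exI[of _ "{1..m}"] exI[of _ "{m<..n}"] conjI)
qed

end
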